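(* Let $(X_1,\dots,X_n)$ be a tuple of (not necessarily selfadjoint) operators in a tracial $W^*$-probability space $(\mathcal{M},\tau)$. If $X_1,\dots,X_n$ has a dual system, then $\Delta(X_1,\dots,X_n)=n$.
   Context: Tracial $W^*$-probability space: a von Neumann algebra $\mathcal{M}$ with a faithful normal tracial state $\tau$; $\mathcal{M}$ acts on $L^2(\mathcal{M},\tau)$ by left multiplication. A dual system to $X_1,\dots,X_n$ is a tuple of operators $D_1,\dots,D_n\in B(L^2(\mathcal{M},\tau))$ such that $[X_i,D_j]=\delta_{ij}P_\Omega$ for all $i,j$, where $P_\Omega$ is the orthogonal projection onto the (span of the) trace vector $\Omega\in L^2(\mathcal{M},\tau)$ (the class of $1\in\mathcal{M}$). $\Delta$: let $\mathcal{F}(L^2(\mathcal{M},\tau))$ be the finite rank operators on $L^2(\mathcal{M},\tau)$ and $J$ the conjugate-linear isometry of $L^2(\mathcal{M},\tau)$ extending $x\mapsto x^*$ on $\mathcal{M}$. Then $$\Delta(X):=n-\dim_{\mathcal{M}\overline{\otimes}\mathcal{M}^{\mathrm{op}}}\overline{\Big\{(T_1,\dots,T_n)\in\mathcal{F}(L^2(\mathcal{M},\tau))^n : \sum_{j=1}^n[T_j,JX_jJ]=0\Big\}}^{\mathrm{HS}},$$ where the closure is in Hilbert–Schmidt norm and $\dim$ is the Murray–von Neumann dimension for the action $(a\otimes b^{\mathrm{op}})\cdot T=aTb$ of $\mathcal{M}\overline{\otimes}\mathcal{M}^{\mathrm{op}}$ on Hilbert–Schmidt operators (normalized so that the space of all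 Hilbert–Schmidt operators on $L^2(\mathcal{M},\tau)$ has dimension $1$). *)

theory Defs
  imports "HOL-Analysis.Analysis"
begin

text \<open>Complex Hilbert spaces. The inner product is linear in the second argument; that it is
  positive definite is contained in the axiom \<open>norm_eq_sqrt_cinner\<close>.\<close>

class complex_inner_space = real_normed_vector +
  fixes scaleC :: "complex \<Rightarrow> 'a \<Rightarrow> 'a" (infixr "*\<^sub>C" 75)
    and cinner :: "'a \<Rightarrow> 'a \<Rightarrow> complex"
  assumes scaleC_add_right: "c *\<^sub>C (x + y) = c *\<^sub>C x + c *\<^sub>C y"
    and scaleC_add_left: "(c + d) *\<^sub>C x = c *\<^sub>C x + d *\<^sub>C x"
    and scaleC_scaleC: "c *\<^sub>C (d *\<^sub>C x) = (c * d) *\<^sub>C x"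
    and scaleC_one: "1 *\<^sub>C x = x"
    and scaleR_scaleC: "r *\<^sub>R x = complex_of_real r *\<^sub>C x"
    and cinner_commute: "cinner x y = cnj (cinner y x)"
    and cinner_add_right: "cinner x (y + z) = cinner x y + cinner x z"
    and cinner_scaleC_right: "cinner x (c *\<^sub>C y) = c * cinner x y"
    and norm_eq_sqrt_cinner: "norm x = sqrt (Re (cinner x x))"

class chilbert_space = complex_inner_space + complete_space

abbreviation cspan :: "'a::complex_inner_space set \<Rightarrow> 'a set" where
  "cspan \<equiv> module.span scaleC"

text \<open>Operators are plain functions; membership in \<open>B(H)\<close> is the following predicate.\<close>

definition bounded_clinear ::
    "('a::complex_inner_space \<Rightarrow> 'b::complex_inner_space) \<Rightarrow> bool" where
  "bounded_clinear A \<longleftrightarrow> bounded_linear A \<and> (\<forall>c x. A (c *\<^sub>C x) = c *\<^sub>C A x)"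

definition commutator :: "('a::complex_inner_space \<Rightarrow> 'a) \<Rightarrow> ('a \<Rightarrow> 'a) \<Rightarrow> 'a \<Rightarrow> 'a" where
  "commutator A B = (\<lambda>x. A (B x) - B (A x))"

definition adj :: "('a::chilbert_space \<Rightarrow> 'a) \<Rightarrow> 'a \<Rightarrow> 'a" where
  "adj A = (THE B. \<forall>x y. cinner (A x) y = cinner x (B y))"

definition positive_op :: "('a::chilbert_space \<Rightarrow> 'a) \<Rightarrow> bool" where
  "positive_op A \<longleftrightarrow> (\<forall>x. Im (cinner x (A x)) = 0 \<and> 0 \<le> Re (cinner x (A x)))"

definition op_le :: "('a::chilbert_space \<Rightarrow> 'a) \<Rightarrow> ('a \<Rightarrow> 'a) \<Rightarrow> bool" where
  "op_le A B \<longleftrightarrow> positive_op (\<lambda>x. B x - A x)"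

text \<open>The orthogonal projection onto \<open>S\<close> with respect to the sesquilinear form \<open>ip\<close>: \<open>p\<close> is the
  element of \<open>S\<close> such that \<open>x - p\<close> is orthogonal to \<open>S\<close>. The form is a parameter because this is
  used both for vectors and for tuples of Hilbert--Schmidt operators.\<close>

definition orth_proj :: "('a \<Rightarrow> 'a \<Rightarrow> complex) \<Rightarrow> 'a set \<Rightarrow> 'a \<Rightarrow> 'a" where
  "orth_proj ip S x = (THE p. p \<in> S \<and> (\<forall>y\<in>S. ip y p = ip y x))"


subsection \<open>Tracial \<open>W\<^sup>*\<close>-probability spaces\<close>

definition commutant :: "('a::chilbert_space \<Rightarrow> 'a) set \<Rightarrow> ('a \<Rightarrow> 'a) set" where
  "commutant S = {B. bounded_clinear B \<and> (\<forall>A\<in>S. A \<circ> B = B \<circ> A)}"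

definition von_neumann_algebra :: "('a::chilbert_space \<Rightarrow> 'a) set \<Rightarrow> bool" where
  "von_neumann_algebra M \<longleftrightarrow>
     (\<forall>a\<in>M. bounded_clinear a) \<and> (\<forall>a\<in>M. adj a \<in> M) \<and> commutant (commutant M) = M"

text \<open>Only the values of \<open>\<tau>\<close> on \<open>M\<close> matter. Normality: \<open>\<tau>\<close> preserves least upper bounds of
  bounded upward directed families of positive elements.\<close>

definition state_on :: "('a::chilbert_space \<Rightarrow> 'a) set \<Rightarrow> (('a \<Rightarrow> 'a) \<Rightarrow> complex) \<Rightarrow> bool" where
  "state_on M \<tau> \<longleftrightarrow>
     (\<forall>a\<in>M. \<forall>b\<in>M. \<tau> (\<lambda>x. a x + b x) = \<tau> a + \<tau> b) \<and>
     (\<forall>c. \<forall>a\<in>M. \<tau> (\<lambda>x. c *\<^sub>C a x) = c * \<tau> a) \<and>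
     (\<forall>a\<in>M. positive_op a \<longrightarrow> Im (\<tau> a) = 0 \<and> 0 \<le> Re (\<tau> a)) \<and>
     \<tau> id = 1"

definition normal_on :: "('a::chilbert_space \<Rightarrow> 'a) set \<Rightarrow> (('a \<Rightarrow> 'a) \<Rightarrow> complex) \<Rightarrow> bool" where
  "normal_on M \<tau> \<longleftrightarrow>
     (\<forall>S s. S \<subseteq> M \<and> S \<noteq> {} \<and> (\<forall>a\<in>S. positive_op a) \<and>
        (\<forall>a\<in>S. \<forall>b\<in>S. \<exists>c\<in>S. op_le a c \<and> op_le b c) \<and>
        s \<in> M \<and> (\<forall>a\<in>S. op_le a s) \<and> (\<forall>t\<in>M. (\<forall>a\<in>S. op_le a t) \<longrightarrow> op_le s t)
        \<longrightarrow> Re (\<tau> s) = (SUP a\<in>S. Re (\<tau> a)))"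

definition tracial_W_star_probability_space ::
    "('a::chilbert_space \<Rightarrow> 'a) set \<Rightarrow> (('a \<Rightarrow> 'a) \<Rightarrow> complex) \<Rightarrow> bool" where
  "tracial_W_star_probability_space M \<tau> \<longleftrightarrow>
     von_neumann_algebra M \<and> state_on M \<tau> \<and> normal_on M \<tau> \<and>
     (\<forall>a\<in>M. positive_op a \<and> \<tau> a = 0 \<longrightarrow> a = (\<lambda>_. 0)) \<and>
     (\<forall>a\<in>M. \<forall>b\<in>M. \<tau> (a \<circ> b) = \<tau> (b \<circ> a))"


subsection \<open>The space \<open>L\<^sup>2(M, \<tau>)\<close>\<close>

text \<open>\<open>L\<^sup>2(M, \<tau>)\<close> is the completion of \<open>M\<close> for \<open>\<langle>a, b\<rangle> = \<tau>(a\<^sup>* b)\<close>. Since a type cannot depend on \<open>M\<close>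
  and \<open>\<tau>\<close>, the completion is given by a Hilbert space \<open>'h\<close> together with the canonical map
  \<open>\<eta>\<close> from \<open>M\<close> to \<open>'h\<close> sending an element to its class; these data are unique up to a unique
  unitary compatible with the canonical maps.\<close>

definition is_L2_space ::
    "('k::chilbert_space \<Rightarrow> 'k) set \<Rightarrow> (('k \<Rightarrow> 'k) \<Rightarrow> complex) \<Rightarrow>
     (('k \<Rightarrow> 'k) \<Rightarrow> 'h::chilbert_space) \<Rightarrow> bool" where
  "is_L2_space M \<tau> \<eta> \<longleftrightarrow>
     (\<forall>a\<in>M. \<forall>b\<in>M. \<eta> (\<lambda>x. a x + b x) = \<eta> a + \<eta> b) \<and>
     (\<forall>c. \<forall>a\<in>M. \<eta> (\<lambda>x. c *\<^sub>C a x) = c *\<^sub>C \<eta> a) \<and>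
     (\<forall>a\<in>M. \<forall>b\<in>M. cinner (\<eta> a) (\<eta> b) = \<tau> (adj a \<circ> b)) \<and>
     closure (\<eta> ` M) = UNIV"

definition trace_vector :: "(('k::chilbert_space \<Rightarrow> 'k) \<Rightarrow> 'h::chilbert_space) \<Rightarrow> 'h" where
  "trace_vector \<eta> = \<eta> id"

definition P_Omega :: "(('k::chilbert_space \<Rightarrow> 'k) \<Rightarrow> 'h::chilbert_space) \<Rightarrow> 'h \<Rightarrow> 'h" where
  "P_Omega \<eta> = orth_proj cinner (cspan {trace_vector \<eta>})"

definition left_mult ::
    "('k::chilbert_space \<Rightarrow> 'k) set \<Rightarrow> (('k \<Rightarrow> 'k) \<Rightarrow> 'h::chilbert_space) \<Rightarrow> ('k \<Rightarrow> 'k) \<Rightarrow> 'h \<Rightarrow> 'h"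
  where
  "left_mult M \<eta> a = (THE A. bounded_clinear A \<and> (\<forall>b\<in>M. A (\<eta> b) = \<eta> (a \<circ> b)))"

definition J_op ::
    "('k::chilbert_space \<Rightarrow> 'k) set \<Rightarrow> (('k \<Rightarrow> 'k) \<Rightarrow> 'h::chilbert_space) \<Rightarrow> 'h \<Rightarrow> 'h" where
  "J_op M \<eta> = (THE J. (\<forall>x y. J (x + y) = J x + J y) \<and> (\<forall>c x. J (c *\<^sub>C x) = cnj c *\<^sub>C J x) \<and>
                    (\<forall>x. norm (J x) = norm x) \<and> (\<forall>a\<in>M. J (\<eta> a) = \<eta> (adj a)))"

text \<open>Tuples of length \<open>n\<close> are functions on \<^typ>\<open>nat\<close> restricted to the indices \<open>0, \<dots>, n - 1\<close>.\<close>

definition dual_system ::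
    "('k::chilbert_space \<Rightarrow> 'k) set \<Rightarrow> (('k \<Rightarrow> 'k) \<Rightarrow> 'h::chilbert_space) \<Rightarrow> nat \<Rightarrow>
     (nat \<Rightarrow> 'k \<Rightarrow> 'k) \<Rightarrow> (nat \<Rightarrow> 'h \<Rightarrow> 'h) \<Rightarrow> bool" where
  "dual_system M \<eta> n X D \<longleftrightarrow>
     (\<forall>j<n. bounded_clinear (D j)) \<and>
     (\<forall>i<n. \<forall>j<n. commutator (left_mult M \<eta> (X i)) (D j) = (if i = j then P_Omega \<eta> else (\<lambda>_. 0)))"


subsection \<open>Hilbert--Schmidt operators\<close>

definition is_onb :: "'a::chilbert_space set \<Rightarrow> bool" where
  "is_onb E \<longleftrightarrow> (\<forall>e\<in>E. \<forall>f\<in>E. cinner e f = (if e = f then 1 else 0)) \<and> closure (cspan E) = UNIV"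

definition some_onb :: "'a::chilbert_space set" where
  "some_onb = (SOME E. is_onb E)"

text \<open>Neither of the next two notions depends on the choice of the orthonormal basis;
  \<open>hs_inner S T\<close> is the trace of \<open>S\<^sup>* T\<close>.\<close>

definition hilbert_schmidt :: "('a::chilbert_space \<Rightarrow> 'a) \<Rightarrow> bool" where
  "hilbert_schmidt T \<longleftrightarrow> bounded_clinear T \<and> (\<lambda>e. (norm (T e))\<^sup>2) summable_on some_onb"

definition hs_inner :: "('a::chilbert_space \<Rightarrow> 'a) \<Rightarrow> ('a \<Rightarrow> 'a) \<Rightarrow> complex" where
  "hs_inner S T = (\<Sum>\<^sub>\<infinity>e\<in>some_onb. cinner (S e) (T e))"

definition finite_rank :: "('a::chilbert_space \<Rightarrow> 'a) \<Rightarrow> bool" where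
  "finite_rank T \<longleftrightarrow> bounded_clinear T \<and> (\<exists>B. finite B \<and> range T \<subseteq> cspan B)"

text \<open>The Hilbert space \<open>HS\<^sup>n\<close>. Tuples vanish beyond the index range, so that equality of tuples
  is equality of functions.\<close>

definition hs_tuples :: "nat \<Rightarrow> (nat \<Rightarrow> 'a::chilbert_space \<Rightarrow> 'a) set" where
  "hs_tuples n = {T. (\<forall>i<n. hilbert_schmidt (T i)) \<and> (\<forall>i\<ge>n. T i = (\<lambda>_. 0))}"

definition hs_tuple_inner ::
    "nat \<Rightarrow> (nat \<Rightarrow> 'a::chilbert_space \<Rightarrow> 'a) \<Rightarrow> (nat \<Rightarrow> 'a \<Rightarrow> 'a) \<Rightarrow> complex" where
  "hs_tuple_inner n S T = (\<Sum>i<n. hs_inner (S i) (T i))"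

definition hs_dist ::
    "nat \<Rightarrow> (nat \<Rightarrow> 'a::chilbert_space \<Rightarrow> 'a) \<Rightarrow> (nat \<Rightarrow> 'a \<Rightarrow> 'a) \<Rightarrow> real" where
  "hs_dist n S T = sqrt (Re (hs_tuple_inner n (\<lambda>i x. S i x - T i x) (\<lambda>i x. S i x - T i x)))"

definition hs_closure ::
    "nat \<Rightarrow> (nat \<Rightarrow> 'a::chilbert_space \<Rightarrow> 'a) set \<Rightarrow> (nat \<Rightarrow> 'a \<Rightarrow> 'a) set" where
  "hs_closure n F = {T \<in> hs_tuples n. \<forall>\<epsilon>>0. \<exists>S\<in>F. hs_dist n T S < \<epsilon>}"


subsection \<open>Murray--von Neumann dimension\<close>

text \<open>The action of \<open>a \<otimes> b\<^sup>o\<^sup>p\<close> on tuples of operators on \<open>L\<^sup>2(M, \<tau>)\<close>, for \<open>a\<close> and \<open>b\<close> in \<open>M\<close>.\<close>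

definition bimodule_act ::
    "('k::chilbert_space \<Rightarrow> 'k) set \<Rightarrow> (('k \<Rightarrow> 'k) \<Rightarrow> 'h::chilbert_space) \<Rightarrow> ('k \<Rightarrow> 'k) \<Rightarrow> ('k \<Rightarrow> 'k) \<Rightarrow>
     (nat \<Rightarrow> 'h \<Rightarrow> 'h) \<Rightarrow> (nat \<Rightarrow> 'h \<Rightarrow> 'h)" where
  "bimodule_act M \<eta> a b T = (\<lambda>i. left_mult M \<eta> a \<circ> T i \<circ> left_mult M \<eta> b)"

text \<open>Let \<open>N\<close> be the von Neumann algebra tensor product of \<open>M\<close> and \<open>M\<^sup>o\<^sup>p\<close>, with trace \<open>\<tau> \<otimes> \<tau>\<^sup>o\<^sup>p\<close>.
  Then \<open>HS\<close> is \<open>L\<^sup>2(N)\<close>, with \<open>P\<^sub>\<Omega>\<close> as its trace vector: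
  \<open>\<langle>P\<^sub>\<Omega>, a P\<^sub>\<Omega> b\<rangle> = \<tau>(a) \<tau>(b)\<close>, and the span of the operators \<open>a P\<^sub>\<Omega> b\<close> is dense in \<open>HS\<close>.
  By normality, a bounded operator between submodules of \<open>HS\<^sup>n\<close> and \<open>HS\<^sup>m\<close> is \<open>N\<close>-linear iff it
  commutes with the action of the elementary tensors.\<close>

definition module_embedding ::
    "('k::chilbert_space \<Rightarrow> 'k) set \<Rightarrow> (('k \<Rightarrow> 'k) \<Rightarrow> 'h::chilbert_space) \<Rightarrow>
     nat \<Rightarrow> (nat \<Rightarrow> 'h \<Rightarrow> 'h) set \<Rightarrow> nat \<Rightarrow> ((nat \<Rightarrow> 'h \<Rightarrow> 'h) \<Rightarrow> (nat \<Rightarrow> 'h \<Rightarrow> 'h)) \<Rightarrow> bool" where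
  "module_embedding M \<eta> n K m V \<longleftrightarrow>
     V ` K \<subseteq> hs_tuples m \<and>
     (\<forall>S\<in>K. \<forall>T\<in>K. V (\<lambda>i x. S i x + T i x) = (\<lambda>i x. V S i x + V T i x)) \<and>
     (\<forall>c. \<forall>T\<in>K. V (\<lambda>i x. c *\<^sub>C T i x) = (\<lambda>i x. c *\<^sub>C V T i x)) \<and>
     (\<forall>S\<in>K. \<forall>T\<in>K. hs_tuple_inner m (V S) (V T) = hs_tuple_inner n S T) \<and>
     (\<forall>a\<in>M. \<forall>b\<in>M. \<forall>T\<in>K. V (bimodule_act M \<eta> a b T) = bimodule_act M \<eta> a b (V T))"

text \<open>The canonical trace on the commutant of \<open>N\<close> on \<open>L\<^sup>2(N)\<^sup>m\<close>, i.e. the sum over the diagonal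
  blocks of the vector states given by the trace vector, evaluated at the projection onto \<open>L\<close>.\<close>

definition commutant_trace_proj ::
    "(('k::chilbert_space \<Rightarrow> 'k) \<Rightarrow> 'h::chilbert_space) \<Rightarrow> nat \<Rightarrow> (nat \<Rightarrow> 'h \<Rightarrow> 'h) set \<Rightarrow> real" where
  "commutant_trace_proj \<eta> m L =
     (\<Sum>j<m. let \<xi> = (\<lambda>i. if i = j then P_Omega \<eta> else (\<lambda>_. 0))
            in Re (hs_tuple_inner m \<xi> (orth_proj (hs_tuple_inner m) L \<xi>)))"

text \<open>The dimension of a closed \<open>N\<close>-submodule \<open>K\<close> of \<open>HS\<^sup>n\<close>: embed \<open>K\<close> isometrically and
  \<open>N\<close>-linearly in some \<open>L\<^sup>2(N)\<^sup>m\<close> and take the trace of the projection onto the image. The value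
  does not depend on the embedding, and there is one (the inclusion in \<open>HS\<^sup>n\<close>).\<close>

definition MvN_dim ::
    "('k::chilbert_space \<Rightarrow> 'k) set \<Rightarrow> (('k \<Rightarrow> 'k) \<Rightarrow> 'h::chilbert_space) \<Rightarrow>
     nat \<Rightarrow> (nat \<Rightarrow> 'h \<Rightarrow> 'h) set \<Rightarrow> real" where
  "MvN_dim M \<eta> n K =
     (THE d. \<exists>m V. module_embedding M \<eta> n K m V \<and> d = commutant_trace_proj \<eta> m (V ` K))"


subsection \<open>The quantity \<open>\<Delta>\<close>\<close>

definition Delta_relations ::
    "('k::chilbert_space \<Rightarrow> 'k) set \<Rightarrow> (('k \<Rightarrow> 'k) \<Rightarrow> 'h::chilbert_space) \<Rightarrow> nat \<Rightarrow>
     (nat \<Rightarrow> 'k \<Rightarrow> 'k) \<Rightarrow> (nat \<Rightarrow> 'h \<Rightarrow> 'h) set" where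
  "Delta_relations M \<eta> n X =
     {T. (\<forall>j<n. finite_rank (T j)) \<and> (\<forall>j\<ge>n. T j = (\<lambda>_. 0)) \<and>
         (\<forall>x. (\<Sum>j<n. commutator (T j) (J_op M \<eta> \<circ> left_mult M \<eta> (X j) \<circ> J_op M \<eta>) x) = 0)}"

definition Delta ::
    "('k::chilbert_space \<Rightarrow> 'k) set \<Rightarrow> (('k \<Rightarrow> 'k) \<Rightarrow> 'h::chilbert_space) \<Rightarrow> nat \<Rightarrow>
     (nat \<Rightarrow> 'k \<Rightarrow> 'k) \<Rightarrow> real" where
  "Delta M \<eta> n X = real n - MvN_dim M \<eta> n (hs_closure n (Delta_relations M \<eta> n X))"

end

theory Submission
  imports Defs
begin

text \<open>
  The assertion \<open>\<Delta> = n\<close> says that the module of finite rank relations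
  \<open>\<Sum>\<^sub>j [T\<^sub>j, J X\<^sub>j J] = 0\<close> has dimension zero. In fact a dual system leaves no relation besides \<open>T = 0\<close>.

  Write \<open>Y\<^sub>j = J X\<^sub>j J\<close>. Conjugating \<open>[X\<^sub>j, D\<^sub>i] = \<delta>\<^sub>i\<^sub>j P\<^sub>\<Omega>\<close> by \<open>J\<close> gives \<open>[Y\<^sub>j, J D\<^sub>i J] = \<delta>\<^sub>i\<^sub>j P\<^sub>\<Omega>\<close>, since
  \<open>J \<Omega> = \<Omega>\<close>. The \<open>Y\<^sub>j\<close> are right multiplications, so they commute with \<open>M\<close>, and \<open>Z = a J D\<^sub>i J b\<close> satisfies
  \<open>[Y\<^sub>j, Z] = \<delta>\<^sub>i\<^sub>j a P\<^sub>\<Omega> b\<close> for all \<open>a\<close>, \<open>b\<close> in \<open>M\<close>. For a relation \<open>T\<close>, cyclicity of the trace gives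
  \<open>0 = \<Sum>\<^sub>j Tr ([T\<^sub>j, Y\<^sub>j] Z) = \<Sum>\<^sub>j Tr (T\<^sub>j [Y\<^sub>j, Z]) = Tr (T\<^sub>i a P\<^sub>\<Omega> b) = \<langle>b\<^sup>* \<Omega>, T\<^sub>i a \<Omega>\<rangle>\<close>,
  and \<open>T\<^sub>i = 0\<close> follows because \<open>M \<Omega>\<close> is dense. The traces are those of finite rank operators, so they can
  be handled algebraically, as statements about sums of rank one operators
  (\<open>rank_one_sums_same_trace\<close>, \<open>relation_paired_with_dual_operator\<close>); the conclusion is
  \<open>dual_system_imp_no_relations\<close>.

  What surrounds this argument makes its ingredients available. Adjoints, the operators of
  left multiplication, \<open>J\<close> and the Hilbert--Schmidt inner product are given by definite descriptions
  or by a chosen orthonormal basis, so their properties rest on existence theorems: the Riesz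
  representation, extension of bounded maps from a dense subspace, and orthonormal bases. The
  first and the last come from orthogonal projection onto a closed subspace
  (\<open>ex_orthogonal_residual\<close>).
\<close>

section \<open>Geometry of complex inner product spaces\<close>

global_interpretation cvec: vector_space "scaleC :: complex \<Rightarrow> 'a::complex_inner_space \<Rightarrow> 'a"
  by unfold_locales
     (simp_all add: scaleC_add_right scaleC_add_left scaleC_scaleC scaleC_one)

lemma cinner_add_left: "cinner (x + y) z = cinner x z + cinner y z"
  by (metis cinner_add_right cinner_commute complex_cnj_add)

lemma cinner_scaleC_left: "cinner (c *\<^sub>C x) y = cnj c * cinner x y"
  by (metis cinner_commute cinner_scaleC_right complex_cnj_mult)

lemma cinner_zero [simp]: "cinner x 0 = 0" "cinner 0 x = 0"
proof -
  show "cinner x 0 = 0" for x :: 'a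
    using cinner_add_right[of x 0 0] by simp
  then show "cinner 0 x = 0"
    by (metis cinner_commute complex_cnj_zero)
qed

lemma cinner_diff_right: "cinner x (y - z) = cinner x y - cinner x z"
  using cinner_add_right[of x "y - z" z] by simp

lemma cinner_diff_left: "cinner (x - y) z = cinner x z - cinner y z"
  using cinner_add_left[of "x - y" y z] by simp

lemma cinner_sum_right: "cinner x (\<Sum>i\<in>I. f i) = (\<Sum>i\<in>I. cinner x (f i))"
  by (induction I rule: infinite_finite_induct) (simp_all add: cinner_add_right)

lemma cinner_self: "cinner x x = of_real ((norm x)\<^sup>2)"
proof -
  have "0 \<le> Re (cinner x x)"
    using norm_ge_zero[of x] unfolding norm_eq_sqrt_cinner by simp
  then have "(norm x)\<^sup>2 = Re (cinner x x)"
    by (simp add: norm_eq_sqrt_cinner)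
  moreover have "Im (cinner x x) = 0"
    using cinner_commute[of x x] by (simp add: complex_eq_iff)
  ultimately show ?thesis
    by (simp add: complex_eq_iff)
qed

lemma norm_scaleC: "norm (c *\<^sub>C x) = cmod c * norm x"
proof -
  have "complex_of_real ((norm (c *\<^sub>C x))\<^sup>2) = of_real ((cmod c * norm x)\<^sup>2)"
    by (simp only: cinner_self[symmetric] cinner_scaleC_left cinner_scaleC_right)
       (simp add: cinner_self power_mult_distrib complex_norm_square[symmetric] mult_ac)
  then have "(norm (c *\<^sub>C x))\<^sup>2 = (cmod c * norm x)\<^sup>2"
    by (simp only: of_real_eq_iff)
  then show ?thesis
    by (simp add: power2_eq_iff_nonneg)
qed

lemma pythagoras:
  assumes "cinner x y = 0"
  shows "(norm (x + y))\<^sup>2 = (norm x)\<^sup>2 + (norm y)\<^sup>2"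
proof -
  have "cinner y x = 0"
    using assms cinner_commute[of y x] by simp
  then have "complex_of_real ((norm (x + y))\<^sup>2) = of_real ((norm x)\<^sup>2 + (norm y)\<^sup>2)"
    using assms by (simp only: cinner_self[symmetric] cinner_add_left cinner_add_right of_real_add) simp
  then show ?thesis
    by (simp only: of_real_eq_iff)
qed

lemma parallelogram_law:
  fixes x y :: "'a::complex_inner_space"
  shows "(norm (x + y))\<^sup>2 + (norm (x - y))\<^sup>2 = 2 * (norm x)\<^sup>2 + 2 * (norm y)\<^sup>2"
proof -
  have "complex_of_real ((norm (x + y))\<^sup>2 + (norm (x - y))\<^sup>2)
      = of_real (2 * (norm x)\<^sup>2 + 2 * (norm y)\<^sup>2)"
    by (simp only: cinner_self[symmetric] cinner_add_left cinner_add_right cinner_diff_left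
        cinner_diff_right of_real_add of_real_mult) simp
  then show ?thesis
    by (simp only: of_real_eq_iff)
qed

text \<open>Subtracting from \<open>y\<close> its component along \<open>x\<close> leaves a vector orthogonal to \<open>x\<close>. The
  Cauchy--Schwarz inequality and the nearest point property both come from comparing norms here.\<close>

lemma norm_component_decomposition:
  fixes x y :: "'a::complex_inner_space"
  assumes "x \<noteq> 0"
  defines "c \<equiv> cinner x y / of_real ((norm x)\<^sup>2)"
  shows "(norm y)\<^sup>2 = (norm (y - c *\<^sub>C x))\<^sup>2 + (cmod c)\<^sup>2 * (norm x)\<^sup>2"
proof -
  have "cinner x (y - c *\<^sub>C x) = 0"
    using assms by (simp add: cinner_diff_right cinner_scaleC_right cinner_self)
  then have "cinner (c *\<^sub>C x) (y - c *\<^sub>C x) = 0"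
    by (simp add: cinner_scaleC_left)
  from pythagoras[OF this] show ?thesis
    by (simp add: norm_scaleC power_mult_distrib)
qed

lemma Cauchy_Schwarz_cinner: "cmod (cinner x y) \<le> norm x * norm y"
proof (cases "x = 0")
  case False
  let ?c = "cinner x y / of_real ((norm x)\<^sup>2)"
  have "(cmod ?c)\<^sup>2 * (norm x)\<^sup>2 \<le> (norm y)\<^sup>2"
    using norm_component_decomposition[OF False, of y] by simp
  then have "cmod ?c * norm x \<le> norm y"
    by (metis norm_ge_zero power2_le_imp_le power_mult_distrib)
  moreover have "cmod (cinner x y) = cmod ?c * norm x * norm x"
    using False by (simp add: norm_divide norm_mult power2_eq_square)
  ultimately show ?thesis
    by (metis mult.commute mult_right_mono norm_ge_zero)
qed simp

lemma bounded_bilinear_cinner: "bounded_bilinear (cinner :: 'a::complex_inner_space \<Rightarrow> 'a \<Rightarrow> complex)"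
proof
  show "\<exists>K. \<forall>a b :: 'a. cmod (cinner a b) \<le> norm a * norm b * K"
    by (rule exI[of _ 1]) (simp add: Cauchy_Schwarz_cinner)
qed (simp_all add: cinner_add_left cinner_add_right scaleR_scaleC cinner_scaleC_left
      cinner_scaleC_right scaleR_conv_of_real)

lemmas continuous_on_cinner [continuous_intros] =
  bounded_bilinear.continuous_on[OF bounded_bilinear_cinner]

lemma bounded_linear_scaleC: "bounded_linear (\<lambda>x. c *\<^sub>C x)"
proof (rule bounded_linear_intro)
  show "norm (c *\<^sub>C x) \<le> norm x * cmod c" for x :: 'a
    by (simp add: norm_scaleC mult.commute)
qed (simp_all add: scaleC_add_right scaleR_scaleC scaleC_scaleC mult.commute)

lemmas continuous_on_scaleC [continuous_intros] =
  bounded_linear.continuous_on[OF bounded_linear_scaleC]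

lemma bounded_clinearD:
  assumes "bounded_clinear A"
  shows "bounded_linear A" "A (x + y) = A x + A y" "A (x - y) = A x - A y" "A 0 = 0"
    and "A (c *\<^sub>C x) = c *\<^sub>C A x" "A (\<Sum>i\<in>I. f i) = (\<Sum>i\<in>I. A (f i))"
proof -
  show "bounded_linear A" "A (c *\<^sub>C x) = c *\<^sub>C A x"
    using assms by (auto simp: bounded_clinear_def)
  then interpret bounded_linear A by simp
  show "A (x + y) = A x + A y" "A (x - y) = A x - A y" "A 0 = 0"
    "A (\<Sum>i\<in>I. f i) = (\<Sum>i\<in>I. A (f i))"
    by (simp_all add: add diff sum)
qed

lemma bounded_clinear_compose:
  "bounded_clinear A \<Longrightarrow> bounded_clinear B \<Longrightarrow> bounded_clinear (A \<circ> B)"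
  using bounded_linear_compose by (fastforce simp: bounded_clinear_def o_def)


section \<open>Orthogonal projection, adjoints and orthonormal bases\<close>

text \<open>Completeness enters here: by the parallelogram law a sequence in \<open>S\<close> whose distances to
  \<open>v\<close> tend to the infimum is a Cauchy sequence, and its limit is a nearest point of \<open>S\<close>.
  Moving the nearest point along any \<open>y\<close> in \<open>S\<close> cannot decrease the distance, so the
  residual is orthogonal to \<open>y\<close>.\<close>

lemma ex_orthogonal_residual:
  fixes S :: "'a::chilbert_space set"
  assumes sub: "cvec.subspace S" and "closed S"
  obtains p where "p \<in> S" "\<And>y. y \<in> S \<Longrightarrow> cinner y (v - p) = 0"
proof -
  define d where "d = (INF y\<in>S. (norm (v - y))\<^sup>2)"
  have S0: "0 \<in> S" and S_add: "x + y \<in> S" and S_scale: "c *\<^sub>C x \<in> S" if "x \<in> S" "y \<in> S" for c x y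
    using sub that by (auto simp: cvec.subspace_def)
  have ne: "S \<noteq> {}"
    using sub by (auto simp: cvec.subspace_def)
  have bdd: "bdd_below ((\<lambda>y. (norm (v - y))\<^sup>2) ` S)"
    by (rule bdd_belowI[of _ 0]) auto
  have d_le: "d \<le> (norm (v - y))\<^sup>2" if "y \<in> S" for y
    unfolding d_def using that by (intro cINF_lower bdd)
  have "\<exists>y\<in>S. (norm (v - y))\<^sup>2 < d + 1 / real (Suc k)" for k
    using cINF_less_iff[OF ne bdd, of "d + 1 / real (Suc k)"] by (simp add: d_def)
  then obtain Y where Y: "\<And>k. Y k \<in> S" "\<And>k. (norm (v - Y k))\<^sup>2 < d + 1 / real (Suc k)"
    by metis
  have close: "(norm (Y k - Y l))\<^sup>2 \<le> 2 / real (Suc k) + 2 / real (Suc l)" for k l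
  proof -
    have mid: "(1/2) *\<^sub>R (Y k + Y l) \<in> S"
      unfolding scaleR_scaleC using Y by (intro S_scale S_add)
    have "(v - Y k) + (v - Y l) = 2 *\<^sub>R (v - (1/2) *\<^sub>R (Y k + Y l))"
      by (simp add: algebra_simps scaleR_2)
    then have "(norm ((v - Y k) + (v - Y l)))\<^sup>2 = 4 * (norm (v - (1/2) *\<^sub>R (Y k + Y l)))\<^sup>2"
      by (simp only: norm_scaleR power_mult_distrib) simp
    with d_le[OF mid] have "4 * d \<le> (norm ((v - Y k) + (v - Y l)))\<^sup>2"
      by simp
    moreover have "(norm ((v - Y k) - (v - Y l)))\<^sup>2 = (norm (Y k - Y l))\<^sup>2"
      by (simp add: norm_minus_commute)
    ultimately show ?thesis
      using parallelogram_law[of "v - Y k" "v - Y l"] Y(2)[of k] Y(2)[of l] by linarith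
  qed
  have "Cauchy Y"
  proof (rule metric_CauchyI)
    fix e :: real assume "0 < e"
    then obtain N where N: "4 / e\<^sup>2 < real N"
      using reals_Archimedean2 by blast
    have "dist (Y k) (Y l) < e" if "k \<ge> N" "l \<ge> N" for k l
    proof -
      have "2 / real (Suc j) < e\<^sup>2 / 2" if "j \<ge> N" for j
      proof -
        have "4 / e\<^sup>2 < real (Suc j)"
          using N that by linarith
        then show ?thesis
          using \<open>0 < e\<close> by (simp add: field_simps)
      qed
      from this[OF \<open>k \<ge> N\<close>] this[OF \<open>l \<ge> N\<close>] have "(norm (Y k - Y l))\<^sup>2 < e\<^sup>2"
        using close[of k l] by linarith
      then show ?thesis
        using \<open>0 < e\<close> by (simp add: dist_norm power2_less_imp_less)
    qed
    then show "\<exists>M. \<forall>m\<ge>M. \<forall>n\<ge>M. dist (Y m) (Y n) < e"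
      by blast
  qed
  then obtain p where lim: "Y \<longlonglongrightarrow> p"
    using Cauchy_convergent convergent_def by blast
  have p: "p \<in> S"
    using closed_sequentially[OF \<open>closed S\<close> _ lim] Y(1) by blast
  have p_le: "(norm (v - p))\<^sup>2 \<le> d"
  proof (rule LIMSEQ_le)
    show "(\<lambda>k. (norm (v - Y k))\<^sup>2) \<longlonglongrightarrow> (norm (v - p))\<^sup>2"
      by (intro tendsto_intros lim)
    show "(\<lambda>k. d + 1 / real (Suc k)) \<longlonglongrightarrow> d"
      using tendsto_add[OF tendsto_const LIMSEQ_inverse_real_of_nat, of d] by (simp add: inverse_eq_divide)
    show "\<exists>N. \<forall>k\<ge>N. (norm (v - Y k))\<^sup>2 \<le> d + 1 / real (Suc k)"
      using Y(2) less_imp_le by blast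
  qed
  have "cinner y (v - p) = 0" if "y \<in> S" for y
  proof (cases "y = 0")
    case False
    let ?c = "cinner y (v - p) / of_real ((norm y)\<^sup>2)"
    have "p + ?c *\<^sub>C y \<in> S"
      using p that by (intro S_add S_scale)
    from d_le[OF this] have "d \<le> (norm ((v - p) - ?c *\<^sub>C y))\<^sup>2"
      by (simp only: diff_diff_eq)
    with p_le norm_component_decomposition[OF False, of "v - p"]
    have "(cmod ?c)\<^sup>2 * (norm y)\<^sup>2 \<le> 0"
      by linarith
    with False show ?thesis
      by (auto simp: mult_le_0_iff)
  qed simp
  with p show thesis
    by (rule that)
qed

lemma Riesz_representation:
  fixes f :: "'a::chilbert_space \<Rightarrow> complex"
  assumes "bounded_linear f" and scale: "\<And>c x. f (c *\<^sub>C x) = c * f x"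
  shows "\<exists>z. \<forall>x. f x = cinner z x"
proof (cases "\<exists>v. f v \<noteq> 0")
  case True
  then obtain v where v: "f v \<noteq> 0" ..
  interpret f: bounded_linear f by fact
  let ?S = "{x. f x = 0}"
  have "cvec.subspace ?S"
    by (auto simp: cvec.subspace_def f.add f.zero scale)
  moreover have "closed ?S"
    by (intro closed_Collect_eq continuous_intros f.continuous_on)
  ultimately obtain p where p: "f p = 0" and orth: "\<And>y. f y = 0 \<Longrightarrow> cinner y (v - p) = 0"
    using ex_orthogonal_residual[of ?S v] by auto
  define u where "u = v - p"
  have fu: "f u \<noteq> 0"
    using v p by (simp add: u_def f.diff)
  then have "u \<noteq> 0"
    by (auto simp: f.zero)
  have "f x = cinner (cnj (f u / of_real ((norm u)\<^sup>2)) *\<^sub>C u) x" for x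
  proof -
    have "f (x - (f x / f u) *\<^sub>C u) = 0"
      using fu by (simp add: f.diff scale)
    then have "cinner (x - (f x / f u) *\<^sub>C u) u = 0"
      using orth by (simp add: u_def)
    then have "cinner u (x - (f x / f u) *\<^sub>C u) = 0"
      by (metis cinner_commute complex_cnj_zero)
    then have "cinner u x = f x / f u * of_real ((norm u)\<^sup>2)"
      by (simp add: cinner_diff_right cinner_scaleC_right cinner_self)
    then show ?thesis
      using fu \<open>u \<noteq> 0\<close> by (simp add: cinner_scaleC_left)
  qed
  then show ?thesis
    by blast
qed (auto intro: exI[of _ 0])

lemma cinner_adj:
  fixes A :: "'a::chilbert_space \<Rightarrow> 'a"
  assumes "bounded_clinear A"
  shows "cinner (A x) y = cinner x (adj A y)" "cinner x (A y) = cinner (adj A x) y"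
proof -
  interpret A: bounded_linear A
    using assms by (rule bounded_clinearD)
  have "\<exists>z. \<forall>x. cinner y (A x) = cinner z x" for y
  proof (rule Riesz_representation)
    show "bounded_linear (\<lambda>x. cinner y (A x))"
      by (rule bounded_linear_compose[OF bounded_bilinear.bounded_linear_right[OF
            bounded_bilinear_cinner] A.bounded_linear_axioms])
    show "cinner y (A (c *\<^sub>C x)) = c * cinner y (A x)" for c x
      by (simp add: bounded_clinearD(5)[OF assms] cinner_scaleC_right)
  qed
  then obtain B where "\<And>x y. cinner y (A x) = cinner (B y) x"
    by metis
  then have B: "\<forall>x y. cinner (A x) y = cinner x (B y)"
    by (metis cinner_commute)
  have "\<forall>x y. cinner (A x) y = cinner x (adj A y)"
    unfolding adj_def
  proof (rule theI[where P = "\<lambda>B. \<forall>x y. cinner (A x) y = cinner x (B y)", OF B])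
    fix C assume "\<forall>x y. cinner (A x) y = cinner x (C y)"
    then have "cinner (C y - B y) (C y - B y) = 0" for y
      using B by (simp add: cinner_diff_right)
    then show "C = B"
      by (auto simp: cinner_self)
  qed
  then show "cinner (A x) y = cinner x (adj A y)" "cinner x (A y) = cinner (adj A x) y"
    by (metis cinner_commute)+
qed

lemma adj_eqI:
  fixes A :: "'a::chilbert_space \<Rightarrow> 'a"
  assumes "bounded_clinear A" "\<And>x y. cinner (A x) y = cinner x (B y)"
  shows "adj A = B"
proof
  fix y
  have "cinner (adj A y - B y) (adj A y - B y) = 0"
    using assms(2) cinner_adj(1)[OF assms(1)] by (simp add: cinner_diff_right)
  then show "adj A y = B y"
    by (auto simp: cinner_self)
qed

lemma subspace_closure_cspan:
  "cvec.subspace (closure (cspan E))" for E :: "'a::complex_inner_space set"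
proof (rule cvec.subspaceI)
  show "0 \<in> closure (cspan E)"
    using closure_subset cvec.span_zero by blast
next
  fix x y assume "x \<in> closure (cspan E)" "y \<in> closure (cspan E)"
  then obtain f g where "\<forall>n. f n \<in> cspan E" "f \<longlonglongrightarrow> x" "\<forall>n. g n \<in> cspan E" "g \<longlonglongrightarrow> y"
    by (auto simp: closure_sequential)
  then have "\<forall>n. f n + g n \<in> cspan E" "(\<lambda>n. f n + g n) \<longlonglongrightarrow> x + y"
    by (auto intro: cvec.span_add tendsto_add)
  then show "x + y \<in> closure (cspan E)"
    unfolding closure_sequential by (intro exI[of _ "\<lambda>n. f n + g n"]) simp
next
  fix c x assume "x \<in> closure (cspan E)"
  then obtain f where "\<forall>n. f n \<in> cspan E" "f \<longlonglongrightarrow> x"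
    by (auto simp: closure_sequential)
  then have "\<forall>n. c *\<^sub>C f n \<in> cspan E" "(\<lambda>n. c *\<^sub>C f n) \<longlonglongrightarrow> c *\<^sub>C x"
    by (auto intro: cvec.span_scale bounded_linear.tendsto[OF bounded_linear_scaleC])
  then show "c *\<^sub>C x \<in> closure (cspan E)"
    unfolding closure_sequential by (intro exI[of _ "\<lambda>n. c *\<^sub>C f n"]) simp
qed

text \<open>A maximal orthonormal set is a basis: otherwise the normalized residual of a vector outside
  the closed span could be added to it.\<close>

lemma is_onb_some_onb: "is_onb (some_onb :: 'a::chilbert_space set)"
proof -
  define ON where "ON = {E :: 'a set. \<forall>e\<in>E. \<forall>f\<in>E. cinner e f = (if e = f then 1 else 0)}"
  have "\<exists>E\<in>ON. \<forall>F\<in>ON. E \<subseteq> F \<longrightarrow> F = E"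
  proof (rule subset_Zorn')
    fix C assume C: "subset.chain ON C"
    show "\<Union>C \<in> ON"
      unfolding ON_def
    proof (intro CollectI ballI)
      fix e f assume "e \<in> \<Union>C" "f \<in> \<Union>C"
      then obtain E F where "E \<in> C" "F \<in> C" "e \<in> E" "f \<in> F"
        by blast
      with C obtain G where "G \<in> C" "e \<in> G" "f \<in> G"
        unfolding subset.chain_def by blast
      with C show "cinner e f = (if e = f then 1 else 0)"
        unfolding subset.chain_def ON_def by blast
    qed
  qed
  then obtain E where E: "E \<in> ON" and maximal: "\<And>F. F \<in> ON \<Longrightarrow> E \<subseteq> F \<Longrightarrow> F = E"
    by blast
  have "closure (cspan E) = UNIV"
  proof (rule ccontr)
    assume "closure (cspan E) \<noteq> UNIV"
    then obtain v where v: "v \<notin> closure (cspan E)"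
      by blast
    obtain p where p: "p \<in> closure (cspan E)"
      and orth: "\<And>y. y \<in> closure (cspan E) \<Longrightarrow> cinner y (v - p) = 0"
      using ex_orthogonal_residual[OF subspace_closure_cspan closed_closure] by blast
    define u where "u = complex_of_real (1 / norm (v - p)) *\<^sub>C (v - p)"
    have "v - p \<noteq> 0"
      using v p by auto
    then have "norm u = 1"
      by (simp add: u_def norm_scaleC norm_divide)
    then have uu: "cinner u u = 1"
      by (simp add: cinner_self)
    have eu: "cinner e u = 0" "cinner u e = 0" if "e \<in> E" for e
    proof -
      have "e \<in> closure (cspan E)"
        using that closure_subset cvec.span_base by blast
      then show "cinner e u = 0"
        by (simp add: u_def cinner_scaleC_right orth)
      then show "cinner u e = 0"
        by (metis cinner_commute complex_cnj_zero)
    qed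
    have "insert u E \<in> ON"
      using E uu eu unfolding ON_def by auto
    then have "u \<in> E"
      using maximal[of "insert u E"] by blast
    with eu uu show False
      by auto
  qed
  with E have "\<exists>E :: 'a set. is_onb E"
    unfolding is_onb_def ON_def by blast
  then show ?thesis
    unfolding some_onb_def by (rule someI_ex)
qed


section \<open>Extension of maps from a dense subspace\<close>

lemma eq_on_dense:
  fixes f g :: "'a::topological_space \<Rightarrow> 'b::t2_space"
  assumes "closure S = UNIV" "continuous_on UNIV f" "continuous_on UNIV g" "\<And>x. x \<in> S \<Longrightarrow> f x = g x"
  shows "f x = g x"
proof -
  have "closure S \<subseteq> {x. f x = g x}"
    using assms by (intro closure_minimal closed_Collect_eq) auto
  with assms(1) show ?thesis
    by auto
qed

lemma eq_zero_if_orthogonal_to_dense: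
  fixes x :: "'a::complex_inner_space"
  assumes "closure S = UNIV" "\<And>y. y \<in> S \<Longrightarrow> cinner y x = 0"
  shows "x = 0"
proof -
  have "cinner x x = 0"
    by (rule eq_on_dense[OF assms(1), where g = "\<lambda>_. 0"]) (auto intro!: continuous_intros assms)
  then show ?thesis
    by (simp add: cinner_self)
qed

text \<open>Operators on a completion are given by their values on a dense family \<open>f\<close> indexed by \<open>M\<close>.
  The estimate makes \<open>g\<close> factor through \<open>f\<close> and makes the factor Lipschitz, hence extendable.
  Only real linearity is asked for, so that the same lemma yields left multiplications and the
  conjugate linear \<open>J\<close>.\<close>

lemma ex_bounded_linear_extension:
  fixes f :: "'i \<Rightarrow> 'a::real_normed_vector" and g :: "'i \<Rightarrow> 'b::{real_normed_vector, complete_space}"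
  assumes dense: "closure (f ` M) = UNIV"
    and add: "\<And>a b. a \<in> M \<Longrightarrow> b \<in> M \<Longrightarrow> \<exists>c\<in>M. f c = f a + f b \<and> g c = g a + g b"
    and scale: "\<And>r a. a \<in> M \<Longrightarrow> \<exists>c\<in>M. f c = r *\<^sub>R f a \<and> g c = r *\<^sub>R g a"
    and bound: "\<And>a. a \<in> M \<Longrightarrow> norm (g a) \<le> C * norm (f a)"
  obtains G where "bounded_linear G" "\<And>a. a \<in> M \<Longrightarrow> G (f a) = g a"
proof -
  have lipschitz: "norm (g a - g b) \<le> C * norm (f a - f b)" if "a \<in> M" "b \<in> M" for a b
  proof -
    obtain c where c: "c \<in> M" "f c = (-1) *\<^sub>R f b" "g c = (-1) *\<^sub>R g b"
      using scale[OF \<open>b \<in> M\<close>] by blast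
    obtain d where d: "d \<in> M" "f d = f a + f c" "g d = g a + g c"
      using add[OF \<open>a \<in> M\<close> \<open>c \<in> M\<close>] by blast
    show ?thesis
      using bound[OF d(1)] c d by simp
  qed
  define h where "h y = g (SOME a. a \<in> M \<and> f a = y)" for y
  have h: "h (f a) = g a" if "a \<in> M" for a
  proof -
    let ?b = "SOME b. b \<in> M \<and> f b = f a"
    have b: "?b \<in> M \<and> f ?b = f a"
      using that by (intro someI[of "\<lambda>b. b \<in> M \<and> f b = f a"]) simp
    then have "norm (g ?b - g a) \<le> 0"
      using lipschitz[of ?b a] that by simp
    then show ?thesis
      by (simp add: h_def)
  qed
  \<comment> \<open>The constant \<open>\<bar>C\<bar> + 1\<close> is positive even when \<open>C\<close> is not, so it can serve as a denominator.\<close>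
  have h_lipschitz: "dist (h x) (h y) \<le> (\<bar>C\<bar> + 1) * dist x y" if xy: "x \<in> f ` M" "y \<in> f ` M" for x y
  proof -
    obtain a b where "a \<in> M" "b \<in> M" "x = f a" "y = f b"
      using xy by blast
    then have "dist (h x) (h y) \<le> C * dist x y"
      using lipschitz[of a b] by (simp add: h dist_norm)
    also have "\<dots> \<le> (\<bar>C\<bar> + 1) * dist x y"
      by (intro mult_right_mono) auto
    finally show ?thesis .
  qed
  have "uniformly_continuous_on (f ` M) h"
    unfolding uniformly_continuous_on_def
  proof (intro allI impI)
    fix e :: real assume "0 < e"
    have "dist (h y) (h x) < e" if "x \<in> f ` M" "y \<in> f ` M" "dist y x < e / (\<bar>C\<bar> + 1)" for x y
    proof -
      have "(\<bar>C\<bar> + 1) * dist y x < e"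
        using that(3) by (simp add: field_simps)
      with h_lipschitz[OF that(2,1)] show ?thesis
        by linarith
    qed
    then show "\<exists>d>0. \<forall>x\<in>f ` M. \<forall>x'\<in>f ` M. dist x' x < d \<longrightarrow> dist (h x') (h x) < e"
      using \<open>0 < e\<close> by (intro exI[of _ "e / (\<bar>C\<bar> + 1)"]) auto
  qed
  then obtain G where "uniformly_continuous_on (closure (f ` M)) G"
    and Gh: "\<And>x. x \<in> f ` M \<Longrightarrow> h x = G x"
    using uniformly_continuous_on_extension_on_closure[of "f ` M" h] by metis
  then have cont: "continuous_on UNIV G"
    using dense uniformly_continuous_imp_continuous by auto
  note cont' = continuous_on_compose2[OF cont _ subset_UNIV]
  have G: "G (f a) = g a" if "a \<in> M" for a
    using Gh[of "f a"] h[OF that] that by simp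
  have G_add: "G (x + y) = G x + G y" for x y
  proof -
    have "G (f a + y) = G (f a) + G y" if a: "a \<in> M" for a y
    proof (rule eq_on_dense[OF dense])
      fix z assume "z \<in> f ` M"
      then obtain b where b: "b \<in> M" "z = f b"
        by blast
      then obtain c where "c \<in> M" "f c = f a + f b" "g c = g a + g b"
        using add[OF a] by blast
      with a b show "G (f a + z) = G (f a) + G z"
        by (metis G)
    qed (intro continuous_intros cont' cont)+
    then have on_dense: "G (z + y) = G z + G y" if "z \<in> f ` M" for z
      using that by blast
    show ?thesis
      by (rule eq_on_dense[OF dense _ _ on_dense]) (intro continuous_intros cont' cont)+
  qed
  have G_scale: "G (r *\<^sub>R x) = r *\<^sub>R G x" for r x
  proof (rule eq_on_dense[OF dense])
    fix z assume "z \<in> f ` M"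
    then obtain a where a: "a \<in> M" "z = f a"
      by blast
    then obtain c where "c \<in> M" "f c = r *\<^sub>R f a" "g c = r *\<^sub>R g a"
      using scale by blast
    with a show "G (r *\<^sub>R z) = r *\<^sub>R G z"
      by (metis G)
  qed (intro continuous_intros cont' cont)+
  have G_bound: "norm (G x) \<le> norm x * C" for x
  proof -
    have "closure (f ` M) \<subseteq> {x. norm (G x) \<le> norm x * C}"
      using bound by (intro closure_minimal closed_Collect_le continuous_intros cont) 
        (auto simp: G mult.commute)
    with dense show ?thesis
      by auto
  qed
  show thesis
    by (rule that[OF bounded_linear_intro[OF G_add G_scale G_bound] G])
qed


section \<open>The trace of a product with a finite rank operator\<close>

abbreviation clinear_functional :: "('a::complex_inner_space \<Rightarrow> complex) \<Rightarrow> bool" where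
  "clinear_functional \<equiv> Vector_Spaces.linear scaleC (*)"

lemma clinear_functionalI:
  assumes "\<And>x y. f (x + y) = f x + f y" "\<And>c x. f (c *\<^sub>C x) = c * f x"
  shows "clinear_functional f"
proof -
  have "vector_space ((*) :: complex \<Rightarrow> complex \<Rightarrow> complex)"
    by unfold_locales (simp_all add: algebra_simps)
  with assms show ?thesis
    by (simp add: Vector_Spaces.linear_iff cvec.vector_space_axioms)
qed

lemma clinear_functionalD:
  assumes "clinear_functional f"
  shows "f (x + y) = f x + f y" "f (c *\<^sub>C x) = c * f x" "f (x - y) = f x - f y"
    and "f (\<Sum>i\<in>I. h i) = (\<Sum>i\<in>I. f (h i))"
proof -
  interpret Vector_Spaces.linear scaleC "(*)" f
    by fact
  show "f (x + y) = f x + f y" "f (c *\<^sub>C x) = c * f x" "f (x - y) = f x - f y"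
    "f (\<Sum>i\<in>I. h i) = (\<Sum>i\<in>I. f (h i))"
    by (simp_all add: add scale diff sum)
qed

lemma clinear_functional_compose:
  "clinear_functional f \<Longrightarrow> bounded_clinear A \<Longrightarrow> clinear_functional (\<lambda>x. f (A x))"
  by (rule clinear_functionalI) (simp_all add: bounded_clinearD clinear_functionalD)

text \<open>Both sides are the trace of \<open>R Z\<close>, where \<open>R\<close> is the operator of finite rank that the
  hypothesis presents in two ways as a sum of operators of rank one. Expanding the vectors
  \<open>u k\<close>, \<open>w k\<close> in a common basis turns the hypothesis into equations between functionals, one for
  each basis vector \<open>e\<close>; they are evaluated at \<open>Z e\<close> and summed.\<close>

lemma rank_one_sums_same_trace:
  fixes \<phi> \<psi> :: "'k \<Rightarrow> 'a::complex_inner_space \<Rightarrow> complex" and u w :: "'k \<Rightarrow> 'b::complex_inner_space"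
  assumes "finite K"
    and lin: "\<And>k. k \<in> K \<Longrightarrow> clinear_functional (\<phi> k)" "\<And>k. k \<in> K \<Longrightarrow> clinear_functional (\<psi> k)"
    and Z: "bounded_clinear Z"
    and eq: "\<And>x. (\<Sum>k\<in>K. \<phi> k x *\<^sub>C u k) = (\<Sum>k\<in>K. \<psi> k x *\<^sub>C w k)"
  shows "(\<Sum>k\<in>K. \<phi> k (Z (u k))) = (\<Sum>k\<in>K. \<psi> k (Z (w k)))"
proof -
  obtain E where E: "E \<subseteq> u ` K \<union> w ` K" "cvec.independent E" "u ` K \<union> w ` K \<subseteq> cspan E"
    using cvec.maximal_independent_subset by blast
  have "finite E"
    using E(1) \<open>finite K\<close> by (meson finite_UnI finite_imageI finite_subset)
  define c d where "c k = cvec.representation E (u k)" and "d k = cvec.representation E (w k)" for k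
  have u: "u k = (\<Sum>e\<in>E. c k e *\<^sub>C e)" and w: "w k = (\<Sum>e\<in>E. d k e *\<^sub>C e)" if "k \<in> K" for k
    using that E \<open>finite E\<close> unfolding c_def d_def
    by (auto intro!: cvec.sum_representation_eq[symmetric])
  have coeff: "(\<Sum>k\<in>K. \<phi> k x * c k e) = (\<Sum>k\<in>K. \<psi> k x * d k e)" if "e \<in> E" for e x
  proof -
    have expand: "(\<Sum>k\<in>K. a k *\<^sub>C v k) = (\<Sum>e\<in>E. (\<Sum>k\<in>K. a k * b k e) *\<^sub>C e)"
      if "\<And>k. k \<in> K \<Longrightarrow> v k = (\<Sum>e\<in>E. b k e *\<^sub>C e)" for a and b :: "'k \<Rightarrow> 'b \<Rightarrow> complex" and v :: "'k \<Rightarrow> 'b"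
      using that by (simp add: cvec.scale_sum_right cvec.scale_sum_left scaleC_scaleC cong: sum.cong)
        (rule sum.swap)
    have "(\<Sum>e\<in>E. ((\<Sum>k\<in>K. \<phi> k x * c k e) - (\<Sum>k\<in>K. \<psi> k x * d k e)) *\<^sub>C e) = 0"
      using eq[of x] expand[of u c "\<lambda>k. \<phi> k x", OF u] expand[of w d "\<lambda>k. \<psi> k x", OF w]
      by (simp add: cvec.scale_left_diff_distrib sum_subtractf)
    from cvec.independentD[OF E(2) \<open>finite E\<close> subset_refl this that] show ?thesis
      by simp
  qed
  have expand: "(\<Sum>k\<in>K. \<theta> k (Z (v k))) = (\<Sum>e\<in>E. \<Sum>k\<in>K. \<theta> k (Z e) * b k e)"
    if v: "\<And>k. k \<in> K \<Longrightarrow> v k = (\<Sum>e\<in>E. b k e *\<^sub>C e)"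
      and \<theta>: "\<And>k. k \<in> K \<Longrightarrow> clinear_functional (\<theta> k)"
    for v and b :: "'k \<Rightarrow> 'b \<Rightarrow> complex" and \<theta> :: "'k \<Rightarrow> 'a \<Rightarrow> complex"
  proof -
    have "\<theta> k (Z (v k)) = (\<Sum>e\<in>E. \<theta> k (Z e) * b k e)" if k: "k \<in> K" for k
      by (simp add: v[OF k] bounded_clinearD[OF Z] clinear_functionalD[OF \<theta>[OF k]] mult.commute)
    then show ?thesis
      by (simp cong: sum.cong) (rule sum.swap)
  qed
  show ?thesis
    using coeff by (simp add: expand[of u c \<phi>, OF u lin(1)] expand[of w d \<psi>, OF w lin(2)])
qed

lemma finite_rank_as_rank_one_sum:
  assumes "finite_rank T"
  obtains B \<phi> where "finite B" "\<And>b. clinear_functional (\<phi> b)" "\<And>x. T x = (\<Sum>b\<in>B. \<phi> b x *\<^sub>C b)"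
proof -
  have T: "bounded_clinear T"
    using assms by (simp add: finite_rank_def)
  obtain B0 where "finite B0" "range T \<subseteq> cspan B0"
    using assms unfolding finite_rank_def by blast
  moreover obtain B where B: "B \<subseteq> B0" "cvec.independent B" "B0 \<subseteq> cspan B"
    using cvec.maximal_independent_subset by blast
  ultimately have fin: "finite B" and T_in: "T x \<in> cspan B" for x
    using cvec.span_minimal[OF B(3) cvec.subspace_span] finite_subset by blast+
  show thesis
  proof (rule that[OF fin])
    show "clinear_functional (\<lambda>x. cvec.representation B (T x) b)" for b
      by (rule clinear_functionalI)
         (simp_all add: bounded_clinearD[OF T] cvec.representation_add cvec.representation_scale B(2) T_in)
    show "T x = (\<Sum>b\<in>B. cvec.representation B (T x) b *\<^sub>C b)" for x
      using B(2) T_in fin by (simp add: cvec.sum_representation_eq)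
  qed
qed

text \<open>Multiplying the relation by \<open>Z\<close> and taking the trace gives
  \<open>0 = (\<Sum>j. Tr ([T\<^sub>j, Y\<^sub>j] Z)) = (\<Sum>j. Tr (T\<^sub>j [Y\<^sub>j, Z]))\<close>. If the only nonzero commutator is the rank one
  operator \<open>[Y\<^sub>i, Z] = \<langle>w, \<cdot>\<rangle> v\<close>, this is \<open>\<langle>w, T\<^sub>i v\<rangle>\<close>.\<close>

lemma relation_paired_with_dual_operator:
  fixes T Y :: "nat \<Rightarrow> 'a::chilbert_space \<Rightarrow> 'a"
  assumes T: "\<And>j. j < n \<Longrightarrow> finite_rank (T j)"
    and Y: "\<And>j. j < n \<Longrightarrow> bounded_clinear (Y j)"
    and Z: "bounded_clinear Z"
    and relation: "\<And>x. (\<Sum>j<n. commutator (T j) (Y j) x) = 0"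
    and dual: "\<And>j x. j < n \<Longrightarrow> commutator (Y j) Z x = (if j = i then cinner w x *\<^sub>C v else 0)"
    and "i < n"
  shows "cinner w (T i v) = 0"
proof -
  have "\<forall>j. \<exists>B \<phi>. j < n \<longrightarrow> finite B \<and> (\<forall>b. clinear_functional (\<phi> b)) \<and> (\<forall>x. T j x = (\<Sum>b\<in>B. \<phi> b x *\<^sub>C b))"
    using finite_rank_as_rank_one_sum[OF T] by metis
  then obtain B \<phi> where B: "\<And>j. j < n \<Longrightarrow> finite (B j)"
    and \<phi>: "\<And>j b. j < n \<Longrightarrow> clinear_functional (\<phi> j b)"
    and T_eq: "\<And>j x. j < n \<Longrightarrow> T j x = (\<Sum>b\<in>B j. \<phi> j b x *\<^sub>C b)"
    by metis
  define K where "K = (SIGMA j:{..<n}. B j)"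
  have sum_K: "(\<Sum>k\<in>K. h (fst k) (snd k)) = (\<Sum>j<n. \<Sum>b\<in>B j. h j b)" for h :: "nat \<Rightarrow> 'a \<Rightarrow> 'c::comm_monoid_add"
    unfolding K_def using B by (subst sum.Sigma) (auto simp: case_prod_unfold)
  have "(\<Sum>k\<in>K. \<phi> (fst k) (snd k) (Y (fst k) (Z (snd k)))) = (\<Sum>k\<in>K. \<phi> (fst k) (snd k) (Z (Y (fst k) (snd k))))"
  proof (rule rank_one_sums_same_trace[OF _ _ _ Z, where u = snd])
    show "finite K"
      unfolding K_def using B by (intro finite_SigmaI) auto
    show "clinear_functional (\<lambda>x. \<phi> (fst k) (snd k) (Y (fst k) x))" "clinear_functional (\<phi> (fst k) (snd k))"
      if "k \<in> K" for k
      using that \<phi> Y by (auto simp: K_def intro: clinear_functional_compose)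
    fix x
    have "(\<Sum>j<n. T j (Y j x)) = (\<Sum>j<n. Y j (T j x))"
      using relation[of x] by (simp add: commutator_def sum_subtractf)
    moreover have "T j (Y j x) = (\<Sum>b\<in>B j. \<phi> j b (Y j x) *\<^sub>C b)"
      "Y j (T j x) = (\<Sum>b\<in>B j. \<phi> j b x *\<^sub>C Y j b)" if "j < n" for j
      using that by (simp_all add: T_eq bounded_clinearD(5,6)[OF Y])
    ultimately have "(\<Sum>j<n. \<Sum>b\<in>B j. \<phi> j b (Y j x) *\<^sub>C b) = (\<Sum>j<n. \<Sum>b\<in>B j. \<phi> j b x *\<^sub>C Y j b)"
      by simp
    then show "(\<Sum>k\<in>K. \<phi> (fst k) (snd k) (Y (fst k) x) *\<^sub>C snd k) = (\<Sum>k\<in>K. \<phi> (fst k) (snd k) x *\<^sub>C Y (fst k) (snd k))"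
      by (simp only: sum_K[of "\<lambda>j b. \<phi> j b (Y j x) *\<^sub>C b"] sum_K[of "\<lambda>j b. \<phi> j b x *\<^sub>C Y j b"])
  qed
  then have "0 = (\<Sum>j<n. \<Sum>b\<in>B j. \<phi> j b (Y j (Z b))) - (\<Sum>j<n. \<Sum>b\<in>B j. \<phi> j b (Z (Y j b)))"
    by (simp only: sum_K[of "\<lambda>j b. \<phi> j b (Y j (Z b))"] sum_K[of "\<lambda>j b. \<phi> j b (Z (Y j b))"] diff_self)
  also have "\<dots> = (\<Sum>j<n. \<Sum>b\<in>B j. \<phi> j b (commutator (Y j) Z b))"
    by (simp add: commutator_def clinear_functionalD(3)[OF \<phi>] sum_subtractf)
  also have "\<dots> = (\<Sum>j<n. if j = i then \<Sum>b\<in>B j. \<phi> j b (cinner w b *\<^sub>C v) else 0)"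
  proof (intro sum.cong refl)
    fix j assume "j \<in> {..<n}"
    moreover from this have "\<phi> j b 0 = 0" for b
      using clinear_functionalD(3)[OF \<phi>, of j b 0 0] by simp
    ultimately show "(\<Sum>b\<in>B j. \<phi> j b (commutator (Y j) Z b)) = (if j = i then \<Sum>b\<in>B j. \<phi> j b (cinner w b *\<^sub>C v) else 0)"
      by (simp add: dual)
  qed
  also have "\<dots> = (\<Sum>b\<in>B i. \<phi> i b v * cinner w b)"
    using \<open>i < n\<close> \<phi> by (simp add: clinear_functionalD(2) mult.commute)
  also have "\<dots> = cinner w (T i v)"
    using \<open>i < n\<close> by (simp add: T_eq cinner_sum_right cinner_scaleC_right)
  finally show ?thesis
    by simp
qed


section \<open>The standard form of a tracial von Neumann algebra\<close>

locale tracial_standard_form =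
  fixes M :: "('k::chilbert_space \<Rightarrow> 'k) set"
    and \<tau> :: "('k \<Rightarrow> 'k) \<Rightarrow> complex"
    and \<eta> :: "('k \<Rightarrow> 'k) \<Rightarrow> 'h::chilbert_space"
  assumes tracial: "tracial_W_star_probability_space M \<tau>"
    and L2: "is_L2_space M \<tau> \<eta>"
begin

abbreviation L where "L \<equiv> left_mult M \<eta>"
abbreviation J where "J \<equiv> J_op M \<eta>"
abbreviation \<Omega> where "\<Omega> \<equiv> trace_vector \<eta>"

lemma M_bounded: "a \<in> M \<Longrightarrow> bounded_clinear a"
  and adj_closed: "a \<in> M \<Longrightarrow> adj a \<in> M"
  and bicommutant: "commutant (commutant M) = M"
  using tracial by (auto simp: tracial_W_star_probability_space_def von_neumann_algebra_def)

lemma \<tau>_add: "a \<in> M \<Longrightarrow> b \<in> M \<Longrightarrow> \<tau> (\<lambda>x. a x + b x) = \<tau> a + \<tau> b"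
  and \<tau>_scale: "a \<in> M \<Longrightarrow> \<tau> (\<lambda>x. c *\<^sub>C a x) = c * \<tau> a"
  and \<tau>_pos: "a \<in> M \<Longrightarrow> positive_op a \<Longrightarrow> 0 \<le> Re (\<tau> a)"
  and \<tau>_id: "\<tau> id = 1"
  and \<tau>_trace: "a \<in> M \<Longrightarrow> b \<in> M \<Longrightarrow> \<tau> (a \<circ> b) = \<tau> (b \<circ> a)"
  using tracial by (auto simp: tracial_W_star_probability_space_def state_on_def)

lemma \<eta>_add: "a \<in> M \<Longrightarrow> b \<in> M \<Longrightarrow> \<eta> (\<lambda>x. a x + b x) = \<eta> a + \<eta> b"
  and \<eta>_scale: "a \<in> M \<Longrightarrow> \<eta> (\<lambda>x. c *\<^sub>C a x) = c *\<^sub>C \<eta> a"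
  and \<eta>_inner: "a \<in> M \<Longrightarrow> b \<in> M \<Longrightarrow> cinner (\<eta> a) (\<eta> b) = \<tau> (adj a \<circ> b)"
  and \<eta>_dense: "closure (\<eta> ` M) = UNIV"
  using L2 by (auto simp: is_L2_space_def)

text \<open>By the bicommutant property, membership in \<open>M\<close> is an equational condition, and the closure
  properties of \<open>M\<close> can be read off from it.\<close>

lemma in_M_iff: "B \<in> M \<longleftrightarrow> bounded_clinear B \<and> (\<forall>A\<in>commutant M. \<forall>x. A (B x) = B (A x))"
  by (subst bicommutant[symmetric]) (auto simp: commutant_def[of "commutant M"] fun_eq_iff)

lemma
  assumes "a \<in> M"
  shows add_closed: "b \<in> M \<Longrightarrow> (\<lambda>x. a x + b x) \<in> M"
    and scale_closed: "(\<lambda>x. c *\<^sub>C a x) \<in> M"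
    and comp_closed: "b \<in> M \<Longrightarrow> a \<circ> b \<in> M"
proof -
  have A: "A (x + y) = A x + A y" "A (c *\<^sub>C x) = c *\<^sub>C A x" if "A \<in> commutant M" for A x y c
    using that by (auto simp: commutant_def bounded_clinearD)
  have a: "bounded_clinear a" "\<forall>A\<in>commutant M. \<forall>x. A (a x) = a (A x)"
    using \<open>a \<in> M\<close> by (auto simp: in_M_iff)
  have "bounded_clinear (\<lambda>x. c *\<^sub>C a x)"
    using bounded_linear_compose[OF bounded_linear_scaleC bounded_clinearD(1)[OF a(1)]]
    by (simp add: bounded_clinear_def bounded_clinearD(5)[OF a(1)] scaleC_scaleC mult.commute)
  then show "(\<lambda>x. c *\<^sub>C a x) \<in> M"
    using a(2) by (simp add: in_M_iff A)
  assume "b \<in> M"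
  then have b: "bounded_clinear b" "\<forall>A\<in>commutant M. \<forall>x. A (b x) = b (A x)"
    by (auto simp: in_M_iff)
  have "bounded_clinear (\<lambda>x. a x + b x)"
    using bounded_linear_add[OF bounded_clinearD(1)[OF a(1)] bounded_clinearD(1)[OF b(1)]]
    by (simp add: bounded_clinear_def bounded_clinearD(5)[OF a(1)] bounded_clinearD(5)[OF b(1)] scaleC_add_right)
  then show "(\<lambda>x. a x + b x) \<in> M"
    using a(2) b(2) by (simp add: in_M_iff A)
  show "a \<circ> b \<in> M"
    using bounded_clinear_compose[OF a(1) b(1)] a(2) b(2) by (simp add: in_M_iff)
qed

lemma id_closed: "id \<in> M"
  by (subst bicommutant[symmetric])
     (auto simp: commutant_def bounded_clinear_def id_def bounded_linear_ident)

lemma adj_id: "adj id = (id :: 'k \<Rightarrow> 'k)"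
  by (rule adj_eqI[OF M_bounded[OF id_closed]]) simp

lemma adj_adj: "a \<in> M \<Longrightarrow> adj (adj a) = a"
  by (rule adj_eqI) (auto simp: M_bounded adj_closed cinner_adj(2))

lemma adj_comp: "a \<in> M \<Longrightarrow> b \<in> M \<Longrightarrow> adj (a \<circ> b) = adj b \<circ> adj a"
  by (rule adj_eqI) (auto simp: M_bounded comp_closed cinner_adj(1))

lemma adj_add: "a \<in> M \<Longrightarrow> b \<in> M \<Longrightarrow> adj (\<lambda>x. a x + b x) = (\<lambda>x. adj a x + adj b x)"
  by (rule adj_eqI) (auto simp: M_bounded add_closed cinner_adj(1) cinner_add_left cinner_add_right)

lemma adj_scale: "a \<in> M \<Longrightarrow> adj (\<lambda>x. c *\<^sub>C a x) = (\<lambda>x. cnj c *\<^sub>C adj a x)"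
  by (rule adj_eqI) (auto simp: M_bounded scale_closed cinner_adj(1) cinner_scaleC_left cinner_scaleC_right)

lemmas M_closed = add_closed scale_closed comp_closed id_closed adj_closed

text \<open>Let \<open>K\<close> bound the norm of \<open>a\<close>. Then \<open>K\<^sup>2 b\<^sup>*b - (ab)\<^sup>*(ab)\<close> is a positive element of \<open>M\<close>, and \<open>\<tau>\<close> takes
  it to \<open>K\<^sup>2 \<parallel>\<eta> b\<parallel>\<^sup>2 - \<parallel>\<eta> (ab)\<parallel>\<^sup>2\<close>.\<close>

lemma ex_left_mult_bound:
  assumes a: "a \<in> M"
  shows "\<exists>K. \<forall>b\<in>M. norm (\<eta> (a \<circ> b)) \<le> K * norm (\<eta> b)"
proof -
  obtain K where "0 \<le> K" and K: "\<And>x. norm (a x) \<le> norm x * K"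
    using bounded_linear.nonneg_bounded[OF bounded_clinearD(1)[OF M_bounded[OF a]]] by blast
  have "norm (\<eta> (a \<circ> b)) \<le> K * norm (\<eta> b)" if b: "b \<in> M" for b
  proof -
    define p where "p = (\<lambda>x. complex_of_real (K\<^sup>2) *\<^sub>C (adj b \<circ> b) x)"
    define q where "q = (\<lambda>x. (-1) *\<^sub>C (adj (a \<circ> b) \<circ> (a \<circ> b)) x)"
    note ab = comp_closed[OF a b]
    have pq: "p \<in> M" "q \<in> M"
      unfolding p_def q_def by (intro scale_closed comp_closed adj_closed a b)+
    have "positive_op (\<lambda>x. p x + q x)"
      unfolding positive_op_def
    proof (intro allI)
      fix x
      have "cinner x (p x + q x) = of_real (K\<^sup>2 * (norm (b x))\<^sup>2 - (norm (a (b x)))\<^sup>2)"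
        by (simp add: p_def q_def cinner_add_right cinner_diff_right cinner_scaleC_right cinner_self
            cinner_adj(1)[OF M_bounded[OF b], symmetric] cinner_adj(1)[OF M_bounded[OF ab], symmetric])
      moreover have "(norm (a (b x)))\<^sup>2 \<le> K\<^sup>2 * (norm (b x))\<^sup>2"
        using power_mono[OF K[of "b x"] norm_ge_zero, of 2] by (simp add: power_mult_distrib mult.commute)
      ultimately show "Im (cinner x (p x + q x)) = 0 \<and> 0 \<le> Re (cinner x (p x + q x))"
        by simp
    qed
    then have "0 \<le> Re (\<tau> (\<lambda>x. p x + q x))"
      using pq by (intro \<tau>_pos M_closed)
    also have "\<tau> (\<lambda>x. p x + q x) = of_real (K\<^sup>2 * (norm (\<eta> b))\<^sup>2 - (norm (\<eta> (a \<circ> b)))\<^sup>2)"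
    proof -
      have "\<tau> p = of_real (K\<^sup>2) * of_real ((norm (\<eta> b))\<^sup>2)"
        unfolding p_def cinner_self[symmetric] \<eta>_inner[OF b b] by (intro \<tau>_scale comp_closed adj_closed b)
      moreover have "\<tau> q = (-1) * of_real ((norm (\<eta> (a \<circ> b)))\<^sup>2)"
        unfolding q_def cinner_self[symmetric] \<eta>_inner[OF ab ab] by (intro \<tau>_scale comp_closed adj_closed a b)
      ultimately show ?thesis
        by (simp add: \<tau>_add[OF pq])
    qed
    finally have "(norm (\<eta> (a \<circ> b)))\<^sup>2 \<le> (K * norm (\<eta> b))\<^sup>2"
      by (simp add: power_mult_distrib)
    then show ?thesis
      by (rule power2_le_imp_le) (use \<open>0 \<le> K\<close> in simp)
  qed
  then show ?thesis
    by blast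
qed

lemma eq_on_\<eta>:
  fixes f g :: "'h \<Rightarrow> 'b::t2_space"
  assumes "continuous_on UNIV f" "continuous_on UNIV g" "\<And>a. a \<in> M \<Longrightarrow> f (\<eta> a) = g (\<eta> a)"
  shows "f x = g x"
  by (rule eq_on_dense[OF \<eta>_dense]) (use assms in auto)

lemma
  assumes a: "a \<in> M"
  shows bounded_clinear_L: "bounded_clinear (L a)"
    and L_\<eta>: "b \<in> M \<Longrightarrow> L a (\<eta> b) = \<eta> (a \<circ> b)"
proof -
  have lin: "a (x + y) = a x + a y" "a (c *\<^sub>C x) = c *\<^sub>C a x" for x y c
    by (simp_all add: bounded_clinearD[OF M_bounded[OF a]])
  have \<eta>_a_add: "\<eta> (a \<circ> (\<lambda>x. b x + c x)) = \<eta> (a \<circ> b) + \<eta> (a \<circ> c)" if "b \<in> M" "c \<in> M" for b c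
    using \<eta>_add[OF comp_closed comp_closed, OF a that(1) a that(2)] by (simp add: lin o_def)
  have \<eta>_a_scale: "\<eta> (a \<circ> (\<lambda>x. c *\<^sub>C b x)) = c *\<^sub>C \<eta> (a \<circ> b)" if "b \<in> M" for b c
    using \<eta>_scale[OF comp_closed[OF a that]] by (simp add: lin o_def)
  obtain K where K: "\<And>b. b \<in> M \<Longrightarrow> norm (\<eta> (a \<circ> b)) \<le> K * norm (\<eta> b)"
    using ex_left_mult_bound[OF a] by blast
  obtain A where A: "bounded_linear A" "\<And>b. b \<in> M \<Longrightarrow> A (\<eta> b) = \<eta> (a \<circ> b)"
  proof (rule ex_bounded_linear_extension[OF \<eta>_dense, of "\<lambda>b. \<eta> (a \<circ> b)" K])
    show "\<exists>d\<in>M. \<eta> d = \<eta> b + \<eta> c \<and> \<eta> (a \<circ> d) = \<eta> (a \<circ> b) + \<eta> (a \<circ> c)" if "b \<in> M" "c \<in> M" for b c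
      using that by (intro bexI[of _ "\<lambda>x. b x + c x"]) (simp_all add: \<eta>_add \<eta>_a_add M_closed)
    show "\<exists>c\<in>M. \<eta> c = r *\<^sub>R \<eta> b \<and> \<eta> (a \<circ> c) = r *\<^sub>R \<eta> (a \<circ> b)" if "b \<in> M" for r b
      using that by (intro bexI[of _ "\<lambda>x. of_real r *\<^sub>C b x"])
        (simp_all add: \<eta>_scale \<eta>_a_scale M_closed scaleR_scaleC)
  qed (use K in auto)
  note cont = bounded_linear.continuous_on[OF A(1)]
  have "A (c *\<^sub>C x) = c *\<^sub>C A x" for c x
  proof (rule eq_on_\<eta>[where x = x])
    show "A (c *\<^sub>C \<eta> b) = c *\<^sub>C A (\<eta> b)" if "b \<in> M" for b
      using that by (simp add: \<eta>_scale[symmetric] A(2) M_closed \<eta>_a_scale)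
  qed (intro continuous_intros cont)+
  with A have P: "bounded_clinear A \<and> (\<forall>b\<in>M. A (\<eta> b) = \<eta> (a \<circ> b))"
    by (auto simp: bounded_clinear_def)
  have "bounded_clinear (L a) \<and> (\<forall>b\<in>M. L a (\<eta> b) = \<eta> (a \<circ> b))"
    unfolding left_mult_def
  proof (rule theI[where P = "\<lambda>A. bounded_clinear A \<and> (\<forall>b\<in>M. A (\<eta> b) = \<eta> (a \<circ> b))", OF P])
    fix B assume B: "bounded_clinear B \<and> (\<forall>b\<in>M. B (\<eta> b) = \<eta> (a \<circ> b))"
    have "B x = A x" for x
    proof (rule eq_on_\<eta>[where x = x])
      show "continuous_on UNIV B" "continuous_on UNIV A"
        using B P by (simp_all add: linear_continuous_on bounded_clinearD)
    qed (use B P in auto)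
    then show "B = A" ..
  qed
  then show "bounded_clinear (L a)" "b \<in> M \<Longrightarrow> L a (\<eta> b) = \<eta> (a \<circ> b)"
    by auto
qed

text \<open>The trace property makes \<open>\<eta> a \<mapsto> \<eta> (a\<^sup>*)\<close> isometric: \<open>\<tau> (a a\<^sup>*) = \<tau> (a\<^sup>* a)\<close>.\<close>

lemma
  shows bounded_linear_J: "bounded_linear J"
    and J_scaleC: "J (c *\<^sub>C x) = cnj c *\<^sub>C J x"
    and J_\<eta>: "a \<in> M \<Longrightarrow> J (\<eta> a) = \<eta> (adj a)"
proof -
  have isometric: "norm (\<eta> (adj a)) = norm (\<eta> a)" if "a \<in> M" for a
  proof -
    have "cinner (\<eta> (adj a)) (\<eta> (adj a)) = cinner (\<eta> a) (\<eta> a)"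
      using that by (simp add: \<eta>_inner M_closed adj_adj) (simp add: \<tau>_trace M_closed)
    then have "(norm (\<eta> (adj a)))\<^sup>2 = (norm (\<eta> a))\<^sup>2"
      by (simp only: cinner_self of_real_eq_iff)
    then show ?thesis
      by (simp add: power2_eq_iff_nonneg)
  qed
  obtain A where A: "bounded_linear A" "\<And>a. a \<in> M \<Longrightarrow> A (\<eta> a) = \<eta> (adj a)"
  proof (rule ex_bounded_linear_extension[OF \<eta>_dense, of "\<lambda>a. \<eta> (adj a)" 1])
    show "\<exists>c\<in>M. \<eta> c = \<eta> a + \<eta> b \<and> \<eta> (adj c) = \<eta> (adj a) + \<eta> (adj b)" if "a \<in> M" "b \<in> M" for a b
      using that by (intro bexI[of _ "\<lambda>x. a x + b x"]) (simp_all add: \<eta>_add adj_add M_closed)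
    show "\<exists>b\<in>M. \<eta> b = r *\<^sub>R \<eta> a \<and> \<eta> (adj b) = r *\<^sub>R \<eta> (adj a)" if "a \<in> M" for r a
      using that by (intro bexI[of _ "\<lambda>x. of_real r *\<^sub>C a x"])
        (simp_all add: \<eta>_scale adj_scale M_closed scaleR_scaleC)
  qed (use isometric in auto)
  note cont = bounded_linear.continuous_on[OF A(1)]
  have "A (c *\<^sub>C x) = cnj c *\<^sub>C A x" for c x
  proof (rule eq_on_\<eta>[where x = x])
    show "A (c *\<^sub>C \<eta> a) = cnj c *\<^sub>C A (\<eta> a)" if "a \<in> M" for a
      using that by (simp add: \<eta>_scale[symmetric] A(2) M_closed adj_scale)
  qed (intro continuous_intros cont)+
  moreover have "norm (A x) = norm x" for x
    by (rule eq_on_\<eta>[where x = x]) (auto intro!: continuous_intros cont simp: A(2) isometric)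
  moreover have "A (x + y) = A x + A y" for x y
    using A(1) by (simp add: linear_simps)
  ultimately have P: "(\<forall>x y. A (x + y) = A x + A y) \<and> (\<forall>c x. A (c *\<^sub>C x) = cnj c *\<^sub>C A x) \<and>
      (\<forall>x. norm (A x) = norm x) \<and> (\<forall>a\<in>M. A (\<eta> a) = \<eta> (adj a))" (is "?P A")
    using A(2) by blast
  have bounded: "bounded_linear B" if "?P B" for B
    using that by (intro bounded_linear_intro[of _ 1]) (auto simp: scaleR_scaleC)
  have "?P J"
    unfolding J_op_def
  proof (rule theI[where P = ?P, OF P])
    fix B assume B: "?P B"
    have "B x = A x" for x
    proof (rule eq_on_\<eta>[where x = x])
      show "continuous_on UNIV B" "continuous_on UNIV A"
        by (intro linear_continuous_on bounded B A(1))+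
    qed (use A(2) B in auto)
    then show "B = A" ..
  qed
  then show "bounded_linear J" "J (c *\<^sub>C x) = cnj c *\<^sub>C J x" "a \<in> M \<Longrightarrow> J (\<eta> a) = \<eta> (adj a)"
    using bounded by blast+
qed

lemma continuous_on_J [continuous_intros]: "continuous_on S f \<Longrightarrow> continuous_on S (\<lambda>x. J (f x))"
  by (rule bounded_linear.continuous_on[OF bounded_linear_J])

lemma continuous_on_L [continuous_intros]:
  "a \<in> M \<Longrightarrow> continuous_on S f \<Longrightarrow> continuous_on S (\<lambda>x. L a (f x))"
  by (rule bounded_linear.continuous_on[OF bounded_clinearD(1)[OF bounded_clinear_L]])

lemma J_J: "J (J x) = x"
  by (rule eq_on_\<eta>[where x = x]) (auto intro!: continuous_intros simp: J_\<eta> M_closed adj_adj)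

text \<open>The two complex conjugations cancel.\<close>

lemma bounded_clinear_J_conjugate:
  assumes "bounded_clinear A"
  shows "bounded_clinear (J \<circ> A \<circ> J)"
proof -
  have "bounded_linear (\<lambda>x. J (A (J x)))"
    using bounded_linear_compose[OF bounded_linear_J
        bounded_linear_compose[OF bounded_clinearD(1)[OF assms] bounded_linear_J]] .
  then show ?thesis
    by (simp add: bounded_clinear_def o_def J_scaleC bounded_clinearD(5)[OF assms])
qed

text \<open>\<open>J L\<^sub>x J\<close> is right multiplication by \<open>x\<^sup>*\<close>, so the claim is associativity in \<open>M\<close>.\<close>

lemma L_commutes_J_L_J:
  assumes "a \<in> M" "x \<in> M"
  shows "L a (J (L x (J h))) = J (L x (J (L a h)))"
proof (rule eq_on_\<eta>[where x = h])
  show "L a (J (L x (J (\<eta> b)))) = J (L x (J (L a (\<eta> b))))" if "b \<in> M" for b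
    using assms that by (simp add: J_\<eta> L_\<eta> M_closed adj_comp adj_adj o_assoc)
qed (intro continuous_intros assms)+

lemma norm_\<Omega>: "norm \<Omega> = 1"
proof -
  have "cinner \<Omega> \<Omega> = 1"
    by (simp add: trace_vector_def \<eta>_inner id_closed adj_id \<tau>_id)
  then have "(norm \<Omega>)\<^sup>2 = 1"
    by (simp only: cinner_self of_real_eq_1_iff)
  then show ?thesis
    by (simp add: power2_eq_1_iff) (metis norm_ge_zero neg_0_le_iff_le not_one_le_zero)
qed

lemma P_Omega_eq: "P_Omega \<eta> x = cinner \<Omega> x *\<^sub>C \<Omega>"
proof -
  have \<Omega>\<Omega>: "cinner \<Omega> \<Omega> = 1"
    by (simp add: cinner_self norm_\<Omega>)
  show ?thesis
    unfolding P_Omega_def orth_proj_def cvec.span_singleton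
  proof (rule the_equality)
    fix p assume "p \<in> range (\<lambda>c. c *\<^sub>C \<Omega>) \<and> (\<forall>y\<in>range (\<lambda>c. c *\<^sub>C \<Omega>). cinner y p = cinner y x)"
    then obtain c where c: "p = c *\<^sub>C \<Omega>" and "\<And>d. cinner (d *\<^sub>C \<Omega>) p = cinner (d *\<^sub>C \<Omega>) x"
      by auto
    from this(2)[of 1] c show "p = cinner \<Omega> x *\<^sub>C \<Omega>"
      by (simp add: scaleC_one cinner_scaleC_right \<Omega>\<Omega>)
  qed (auto simp: cinner_scaleC_left cinner_scaleC_right \<Omega>\<Omega>)
qed

text \<open>The reasons are \<open>J \<Omega> = \<Omega>\<close> and \<open>\<langle>J x, \<Omega>\<rangle> = \<langle>\<Omega>, x\<rangle>\<close>; both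
  sides of the latter are \<open>\<tau> a\<close> when \<open>x = a\<Omega>\<close>.\<close>

lemma J_P_Omega_J: "J (P_Omega \<eta> (J x)) = P_Omega \<eta> x"
proof -
  have "J \<Omega> = \<Omega>"
    by (simp add: trace_vector_def J_\<eta> id_closed adj_id)
  moreover have "cinner (J x) \<Omega> = cinner \<Omega> x"
    by (rule eq_on_\<eta>[where x = x]) (auto intro!: continuous_intros
        simp: trace_vector_def J_\<eta> \<eta>_inner M_closed adj_adj adj_id \<tau>_trace)
  ultimately show ?thesis
    by (simp add: P_Omega_eq J_scaleC cinner_commute[of \<Omega> "J x"])
qed

lemma L_\<Omega>: "a \<in> M \<Longrightarrow> L a \<Omega> = \<eta> a"
  by (simp add: trace_vector_def L_\<eta> id_closed)

lemma cinner_\<Omega>_L: "b \<in> M \<Longrightarrow> cinner \<Omega> (L b x) = cinner (\<eta> (adj b)) x"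
  by (rule eq_on_\<eta>[where x = x]) (auto intro!: continuous_intros
        simp: trace_vector_def L_\<eta> \<eta>_inner M_closed adj_adj adj_id)


section \<open>A dual system excludes finite rank relations\<close>

text \<open>Conjugating the dual system by \<open>J\<close> turns it into one for the operators \<open>Y\<^sub>j = J X\<^sub>j J\<close>, which
  commute with \<open>M\<close>. Hence \<open>[Y\<^sub>j, a J D\<^sub>i J b] = \<delta>\<^sub>i\<^sub>j a P\<^sub>\<Omega> b\<close> for all \<open>a\<close>, \<open>b\<close> in \<open>M\<close>, and pairing a relation
  with these operators yields every matrix coefficient \<open>\<langle>b\<^sup>*\<Omega>, T\<^sub>i a\<Omega>\<rangle>\<close>; by density of \<open>M\<Omega>\<close> these
  determine \<open>T\<^sub>i\<close>.\<close>

lemma dual_system_imp_no_relations: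
  assumes X: "\<And>j. j < n \<Longrightarrow> X j \<in> M" and D: "dual_system M \<eta> n X D"
  shows "Delta_relations M \<eta> n X = {\<lambda>_ _. 0}"
proof -
  define Y where "Y j = J \<circ> L (X j) \<circ> J" for j
  have Y: "bounded_clinear (Y j)" if "j < n" for j
    unfolding Y_def using that by (intro bounded_clinear_J_conjugate bounded_clinear_L X)
  have D_bounded: "bounded_clinear (D j)" if "j < n" for j
    using D that by (simp add: dual_system_def)
  have D_comm: "L (X i) (D j x) - D j (L (X i) x) = (if i = j then P_Omega \<eta> x else 0)"
    if "i < n" "j < n" for i j x
  proof -
    have "commutator (L (X i)) (D j) = (if i = j then P_Omega \<eta> else (\<lambda>_. 0))"
      using D that by (simp add: dual_system_def)
    from fun_cong[OF this, of x] show ?thesis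
      by (simp add: commutator_def)
  qed
  have comm: "commutator (Y j) (L a \<circ> (J \<circ> D i \<circ> J) \<circ> L b) x
      = (if j = i then cinner (\<eta> (adj b)) x *\<^sub>C \<eta> a else 0)"
    if "i < n" "j < n" "a \<in> M" "b \<in> M" for i j a b x
  proof -
    have aY: "Y j (L a h) = L a (Y j h)" and bY: "L b (Y j h) = Y j (L b h)" for h
      using L_commutes_J_L_J[of a "X j" h] L_commutes_J_L_J[of b "X j" h] that X by (auto simp: Y_def)
    \<comment> \<open>As \<open>Y j\<close> commutes with \<open>L a\<close> and \<open>L b\<close>, these move out of the commutator, leaving the
      conjugate by \<open>J\<close> of a commutator of the dual system.\<close>
    define y where "y = L b x"
    have "commutator (Y j) (L a \<circ> (J \<circ> D i \<circ> J) \<circ> L b) x = L a (Y j (J (D i (J y))) - J (D i (J (Y j y))))"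
      using that by (simp add: commutator_def aY bY y_def bounded_clinearD(3)[OF bounded_clinear_L])
    also have "\<dots> = L a (J (L (X j) (D i (J y)) - D i (L (X j) (J y))))"
      by (simp add: Y_def J_J linear_diff[OF bounded_linear.linear[OF bounded_linear_J]])
    also have "\<dots> = (if j = i then L a (J (P_Omega \<eta> (J y))) else 0)"
      using D_comm[of j i] that
      by (simp add: linear_0[OF bounded_linear.linear[OF bounded_linear_J]] bounded_clinearD(4)[OF bounded_clinear_L])
    also have "\<dots> = (if j = i then cinner (\<eta> (adj b)) x *\<^sub>C \<eta> a else 0)"
      unfolding J_P_Omega_J using that
      by (simp add: P_Omega_eq y_def cinner_\<Omega>_L L_\<Omega> bounded_clinearD(5)[OF bounded_clinear_L])
    finally show ?thesis .
  qed
  have "T = (\<lambda>_ _. 0)" if "T \<in> Delta_relations M \<eta> n X" for T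
  proof (intro ext)
    have T: "\<And>j. j < n \<Longrightarrow> finite_rank (T j)" "\<And>j. j \<ge> n \<Longrightarrow> T j = (\<lambda>_. 0)"
      "\<And>x. (\<Sum>j<n. commutator (T j) (Y j) x) = 0"
      using that by (auto simp: Delta_relations_def Y_def)
    fix i x
    show "T i x = 0"
    proof (cases "i < n")
      case True
      have coeff: "cinner (\<eta> (adj b)) (T i (\<eta> a)) = 0" if "a \<in> M" "b \<in> M" for a b
      proof (rule relation_paired_with_dual_operator[OF T(1) Y _ T(3) comm _])
        show "bounded_clinear (L a \<circ> (J \<circ> D i \<circ> J) \<circ> L b)"
          using that True
          by (intro bounded_clinear_compose bounded_clinear_L bounded_clinear_J_conjugate D_bounded)
      qed (use True that in auto)
      have "cinner (\<eta> b) (T i (\<eta> a)) = 0" if "a \<in> M" "b \<in> M" for a b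
        using coeff[of a "adj b"] that by (simp add: M_closed adj_adj)
      then have "T i (\<eta> a) = 0" if "a \<in> M" for a
        using that by (intro eq_zero_if_orthogonal_to_dense[OF \<eta>_dense]) auto
      moreover have "continuous_on UNIV (T i)"
        using T(1)[OF True] by (intro linear_continuous_on) (simp add: finite_rank_def bounded_clinearD)
      ultimately show ?thesis
        by (rule eq_on_\<eta>[where g = "\<lambda>_. 0", OF _ continuous_on_const, rotated])
    qed (simp add: T(2))
  qed
  moreover have "(\<lambda>_ _. 0) \<in> Delta_relations M \<eta> n X"
  proof -
    have "finite_rank (\<lambda>_ :: 'h. 0 :: 'h)"
      unfolding finite_rank_def bounded_clinear_def
      by (auto intro!: exI[of _ "{}"] simp: bounded_linear_zero)
    moreover have "commutator (\<lambda>_. 0) (Y j) x = 0" if "j < n" for j x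
      using bounded_clinearD(4)[OF Y[OF that]] by (simp add: commutator_def)
    ultimately show ?thesis
      by (auto simp: Delta_relations_def Y_def)
  qed
  ultimately show ?thesis
    by blast
qed


section \<open>The zero module\<close>

text \<open>The dimension is a definite description over all embeddings: any embedding of the zero module
  has image zero and gives the value \<open>0\<close>, and the embedding in the zero space shows that the
  value is attained.\<close>

lemma MvN_dim_zero: "MvN_dim M \<eta> n {\<lambda>_ _. 0} = 0"
proof -
  have zero_trace: "commutant_trace_proj \<eta> m {\<lambda>_ _. 0} = 0" for m
  proof -
    have "orth_proj (hs_tuple_inner m) {\<lambda>_ _. 0} \<xi> = (\<lambda>_ _. 0 :: 'h)" for \<xi>
      unfolding orth_proj_def by (rule the_equality) (auto simp: hs_tuple_inner_def hs_inner_def)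
    then show ?thesis
      by (simp add: commutant_trace_proj_def Let_def hs_tuple_inner_def hs_inner_def)
  qed
  have "d = 0" if "module_embedding M \<eta> n {\<lambda>_ _. 0} m V" "d = commutant_trace_proj \<eta> m (V ` {\<lambda>_ _. 0})" for d m V
  proof -
    \<comment> \<open>Homogeneity with factor \<open>0\<close> determines the image.\<close>
    have "\<forall>c. \<forall>T\<in>{\<lambda>_ _. 0}. V (\<lambda>i x. c *\<^sub>C T i x) = (\<lambda>i x. c *\<^sub>C V T i x)"
      using that(1) unfolding module_embedding_def by (elim conjE)
    from bspec[OF spec[OF this, of 0] singletonI] have "V (\<lambda>_ _. 0) = (\<lambda>_ _. 0)"
      by simp
    with that(2) zero_trace show ?thesis
      by simp
  qed
  moreover have "module_embedding M \<eta> n {\<lambda>_ _. 0} 0 (\<lambda>_ _ _. 0)"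
    by (auto simp: module_embedding_def hs_tuples_def hs_tuple_inner_def hs_inner_def bimodule_act_def
        fun_eq_iff bounded_clinearD(4)[OF bounded_clinear_L])
  moreover have "0 = commutant_trace_proj \<eta> 0 ((\<lambda>_ _ _. 0) ` {\<lambda>_ _. 0})"
    by (simp add: zero_trace)
  ultimately show ?thesis
    unfolding MvN_dim_def
    by (intro the_equality[where a = 0 and P = "\<lambda>d. \<exists>m V. module_embedding M \<eta> n {\<lambda>_ _. 0} m V \<and>
          d = commutant_trace_proj \<eta> m (V ` {\<lambda>_ _. 0})"]) blast+
qed

end

text \<open>A Hilbert--Schmidt limit of zero vanishes on an orthonormal basis. As \<open>some_onb\<close> is given by a
  choice operator, the existence of a basis is what makes its span dense.\<close>

lemma hs_closure_zero: "hs_closure n {\<lambda>_ _. 0} = {\<lambda>_ _. 0 :: 'a::chilbert_space}"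
proof -
  have onb: "closure (cspan some_onb) = (UNIV :: 'a set)"
    using is_onb_some_onb[where 'a = 'a] by (simp add: is_onb_def)
  have norm_sq: "Re (hs_inner S S) = (\<Sum>\<^sub>\<infinity>e\<in>some_onb. (norm (S e))\<^sup>2)"
    if "hilbert_schmidt S" for S :: "'a \<Rightarrow> 'a"
  proof -
    have "((\<lambda>e. cinner (S e) (S e)) has_sum of_real (\<Sum>\<^sub>\<infinity>e\<in>some_onb. (norm (S e))\<^sup>2)) some_onb"
      unfolding cinner_self using that by (intro has_sum_of_real has_sum_infsum) (simp add: hilbert_schmidt_def)
    then show ?thesis
      by (simp add: hs_inner_def infsumI)
  qed
  have "T = (\<lambda>_ _. 0)" if T: "T \<in> hs_closure n {\<lambda>_ _. 0}" for T :: "nat \<Rightarrow> 'a \<Rightarrow> 'a"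
  proof (intro ext)
    have hs: "\<And>i. i < n \<Longrightarrow> hilbert_schmidt (T i)" "\<And>i. i \<ge> n \<Longrightarrow> T i = (\<lambda>_. 0)"
      and small: "\<And>\<epsilon>. \<epsilon> > 0 \<Longrightarrow> hs_dist n T (\<lambda>_ _. 0) < \<epsilon>"
      using T by (auto simp: hs_closure_def hs_tuples_def)
    have "hs_dist n T (\<lambda>_ _. 0) \<le> 0"
      using small by (meson less_irrefl not_le)
    then have "(\<Sum>i<n. \<Sum>\<^sub>\<infinity>e\<in>some_onb. (norm (T i e))\<^sup>2) \<le> 0"
      by (simp add: hs_dist_def hs_tuple_inner_def norm_sq hs(1))
    moreover have nonneg: "0 \<le> (\<Sum>\<^sub>\<infinity>e\<in>some_onb. (norm (T i e))\<^sup>2)" for i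
      by (intro infsum_nonneg) simp
    ultimately have "(\<Sum>i<n. \<Sum>\<^sub>\<infinity>e\<in>some_onb. (norm (T i e))\<^sup>2) = 0"
      by (intro antisym sum_nonneg)
    with nonneg have zero: "(\<Sum>\<^sub>\<infinity>e\<in>some_onb. (norm (T i e))\<^sup>2) = 0" if "i < n" for i
      using that by (simp add: sum_nonneg_eq_0_iff)
    fix i x
    show "T i x = 0"
    proof (cases "i < n")
      case True
      have T_bounded: "bounded_clinear (T i)"
        and summable: "(\<lambda>e. (norm (T i e))\<^sup>2) summable_on some_onb"
        using hs(1)[OF True] by (auto simp: hilbert_schmidt_def)
      have "(norm (T i e))\<^sup>2 = 0" if "e \<in> some_onb" for e
        using nonneg_infsum_le_0D[OF _ summable _ that] zero[OF True] by simp
      then have "some_onb \<subseteq> {x. T i x = 0}"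
        by auto
      then have "cspan some_onb \<subseteq> {x. T i x = 0}"
        by (rule cvec.span_minimal) (auto simp: cvec.subspace_def bounded_clinearD[OF T_bounded])
      then show ?thesis
        by - (rule eq_on_dense[OF onb linear_continuous_on[OF bounded_clinearD(1)[OF T_bounded]]
              continuous_on_const], auto)
    qed (simp add: hs(2))
  qed
  moreover have "(\<lambda>_ _. 0) \<in> hs_closure n {\<lambda>_ _. 0 :: 'a}"
    by (simp add: hs_closure_def hs_tuples_def hilbert_schmidt_def bounded_clinear_def
        bounded_linear_zero hs_dist_def hs_tuple_inner_def hs_inner_def)
  ultimately show ?thesis
    by blast
qed

theorem proposition6p2:
  fixes M :: "('k::chilbert_space \<Rightarrow> 'k) set"
    and \<tau> :: "('k \<Rightarrow> 'k) \<Rightarrow> complex"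
    and \<eta> :: "('k \<Rightarrow> 'k) \<Rightarrow> 'h::chilbert_space"
    and n :: nat
    and X :: "nat \<Rightarrow> 'k \<Rightarrow> 'k"
  assumes "tracial_W_star_probability_space M \<tau>"
    and "is_L2_space M \<tau> \<eta>"
    and "\<forall>i<n. X i \<in> M"
    and "\<exists>D. dual_system M \<eta> n X D"
  shows "Delta M \<eta> n X = real n"
proof -
  interpret tracial_standard_form M \<tau> \<eta>
    by unfold_locales fact+
  have "Delta_relations M \<eta> n X = {\<lambda>_ _. 0}"
    using dual_system_imp_no_relations assms(3,4) by blast
  then show ?thesis
    by (simp add: Delta_def hs_closure_zero MvN_dim_zero)
qed

end
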